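(* Let $S=\langle p^*\rangle A\vee Z$ be a basic disjunctive normal expression, with $Z\in\mathcal L_\emptyset$ and $A=F\vee\bigvee_{i=1}^s(F_i\wedge[p]G_i)\vee\bigvee_{j=1}^t(F_{s+j}\wedge\langle p\rangle H_j)$, $s,t>0$. Let $\Xi=\{1,2\}^{\{1,\dots,s+t\}}$ and for $\xi\in\Xi$ put $$B_\xi:=F\vee\bigvee\{F_k:1\le k\le s+t,\ \xi(k)=1\},\qquad C_\xi:=\bigvee\{H_{k-s}:s<k\le s+t,\ \xi(k)=2\},$$ $$J_\xi:=\{k:1\le k\le s,\ \xi(k)=2\},\qquad D_{\xi,j}:=G_j\ \ (j\in J_\xi).$$ Define a boolean-valued function $f(\iota,X)$, for $\iota\ge0$ and propositional formulas $X$, by recursion: 1. $f(0,X)=1$ iff for every $\xi\in\Xi$: either $\vdash_\emptyset B_\xi\vee X$, or $\vdash_\emptyset C_\xi\vee D_{\xi,j}$ for some $j\in J_\xi$; 2. $f(\iota+1,X)=1$ iff for every $\xi\in\Xi$: either $\vdash_\emptyset B_\xi\vee X$, or $f(\iota,C_\xi\vee D_{\xi,j})=1$ for some $j\in J_\xi$. Then there is a quantified boolean formula $\widehat S$, obtained by unfolding the recursive clauses 1–2 for $f(s2^{s+t}+1,Z)=1$ and expressing each $\vdash_\emptyset Y$ as $\forall x_1\cdots\forall x_q\,Y$ (where $x_1,\dots,x_q$ are the propositional variables of $Y$), whose size is exponential in the size of $S$ and such that $$\mathbf{PDL}\vdash S\iff f(s2^{s+t}+1,Z)=1\iff\mathbf{QBL}\vdash\widehat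 S.$$
   Context: Fix an atomic program $p$. $\mathcal L_\emptyset$ is the set of purely propositional formulas, built from literals $x,\neg x$ by $\vee,\wedge$. In a *basic disjunctive normal expression* (BDNE) $\langle p^*\rangle A\vee Z$ of the displayed form, $F,F_k,G_i,H_j\in\mathcal L_\emptyset\cup\{\emptyset\}$, where $\emptyset$ is the empty formula; the empty formula and empty disjunctions are read as false. $\mathbf{PDL}\vdash S$ means that $S$ is provable in Segerberg's Hilbert-style system of propositional dynamic logic, equivalently that $S$ is valid in all Kripke models: $p$ is interpreted by a binary relation $R$ on states, $[p]A$ (resp. $\langle p\rangle A$) holds at $u$ iff $A$ holds at all (resp. some) $v$ with $u\,R\,v$, and $\langle p^*\rangle A$ holds at $u$ iff $A$ holds at some $v$ with $u\,R^*\,v$, $R^*$ the reflexive-transitive closure of $R$. $\vdash_\emptyset Y$ means that the propositional formula $Y$ is a tautology. $\mathbf{QBL}$ is the canonical (sound and complete) proof system for quantified boolean logic. *)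

theory Defs
  imports Main "HOL-Library.FuncSet"
begin

section \<open>Finite disjunctions\<close>

text \<open>Shared by all formula types below; \<open>orop\<close> and \<open>fls\<close> are
  the disjunction and the false constant of the type.\<close>

fun bigor :: "('a \<Rightarrow> 'a \<Rightarrow> 'a) \<Rightarrow> 'a \<Rightarrow> 'a list \<Rightarrow> 'a" where
  "bigor orop fls [] = fls"
| "bigor orop fls [a] = a"
| "bigor orop fls (a # b # as) = orop a (bigor orop fls (b # as))"


section \<open>Purely propositional formulas\<close>

text \<open>\<open>PEmp\<close> is the empty formula, read as false. It is not a member of
  \<open>L0\<close>, but may occur in the disjunctions formed from members of
  \<open>L0 \<union> {PEmp}\<close>.\<close>

datatype pform =
    PEmp
  | PVar nat
  | PNVar nat
  | PAnd pform pform
  | POr pform pform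

inductive_set L0 :: "pform set" where
  "PVar x \<in> L0"
| "PNVar x \<in> L0"
| "\<lbrakk>a \<in> L0; b \<in> L0\<rbrakk> \<Longrightarrow> PAnd a b \<in> L0"
| "\<lbrakk>a \<in> L0; b \<in> L0\<rbrakk> \<Longrightarrow> POr a b \<in> L0"

primrec peval :: "(nat \<Rightarrow> bool) \<Rightarrow> pform \<Rightarrow> bool" where
  "peval v PEmp = False"
| "peval v (PVar x) = v x"
| "peval v (PNVar x) = (\<not> v x)"
| "peval v (PAnd a b) = (peval v a \<and> peval v b)"
| "peval v (POr a b) = (peval v a \<or> peval v b)"

definition ptaut :: "pform \<Rightarrow> bool" where
  "ptaut Y \<longleftrightarrow> (\<forall>v. peval v Y)"


section \<open>Propositional dynamic logic\<close>

datatype 'p prog =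
    Atom 'p
  | Seq "'p prog" "'p prog"
  | Choice "'p prog" "'p prog"
  | Star "'p prog"
  | Test "'p fm"
and 'p fm =
    Bot
  | Var nat
  | Neg "'p fm"
  | And "'p fm" "'p fm"
  | Or "'p fm" "'p fm"
  | Box "'p prog" "'p fm"
  | Dia "'p prog" "'p fm"

abbreviation Imp :: "'p fm \<Rightarrow> 'p fm \<Rightarrow> 'p fm" where
  "Imp a b \<equiv> Or (Neg a) b"

abbreviation Iff :: "'p fm \<Rightarrow> 'p fm \<Rightarrow> 'p fm" where
  "Iff a b \<equiv> And (Imp a b) (Imp b a)"

text \<open>Size counts occurrences of variables, atomic programs, constants and connectives.\<close>

primrec gsize :: "'p prog \<Rightarrow> nat" and fsize :: "'p fm \<Rightarrow> nat" where
  "gsize (Atom a) = 1"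
| "gsize (Seq a b) = gsize a + gsize b + 1"
| "gsize (Choice a b) = gsize a + gsize b + 1"
| "gsize (Star a) = gsize a + 1"
| "gsize (Test A) = fsize A + 1"
| "fsize Bot = 1"
| "fsize (Var x) = 1"
| "fsize (Neg A) = fsize A + 1"
| "fsize (And A B) = fsize A + fsize B + 1"
| "fsize (Or A B) = fsize A + fsize B + 1"
| "fsize (Box a A) = gsize a + fsize A + 1"
| "fsize (Dia a A) = gsize a + fsize A + 1"

text \<open>Boolean evaluation with variables and modal formulas as atoms, so that
  \<open>\<forall>v. fm_beval v A\<close> says that \<open>A\<close> is a substitution instance
  of a propositional tautology.\<close>

fun fm_beval :: "('p fm \<Rightarrow> bool) \<Rightarrow> 'p fm \<Rightarrow> bool" where
  "fm_beval v Bot = False"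
| "fm_beval v (Neg A) = (\<not> fm_beval v A)"
| "fm_beval v (And A B) = (fm_beval v A \<and> fm_beval v B)"
| "fm_beval v (Or A B) = (fm_beval v A \<or> fm_beval v B)"
| "fm_beval v A = v A"

text \<open>Segerberg's system. Since both modalities are primitive, their duality is an axiom.\<close>

inductive PDL_prov :: "'p fm \<Rightarrow> bool" where
  Taut: "(\<forall>v. fm_beval v A) \<Longrightarrow> PDL_prov A"
| K: "PDL_prov (Imp (Box a (Imp A B)) (Imp (Box a A) (Box a B)))"
| BoxAnd: "PDL_prov (Iff (Box a (And A B)) (And (Box a A) (Box a B)))"
| Dual: "PDL_prov (Iff (Dia a A) (Neg (Box a (Neg A))))"
| BoxChoice: "PDL_prov (Iff (Box (Choice a b) A) (And (Box a A) (Box b A)))"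
| BoxSeq: "PDL_prov (Iff (Box (Seq a b) A) (Box a (Box b A)))"
| BoxTest: "PDL_prov (Iff (Box (Test B) A) (Imp B A))"
| Mix: "PDL_prov (Iff (And A (Box a (Box (Star a) A))) (Box (Star a) A))"
| Ind: "PDL_prov (Imp (And A (Box (Star a) (Imp A (Box a A)))) (Box (Star a) A))"
| MP: "\<lbrakk>PDL_prov (Imp A B); PDL_prov A\<rbrakk> \<Longrightarrow> PDL_prov B"
| Nec: "PDL_prov A \<Longrightarrow> PDL_prov (Box a A)"


section \<open>Basic disjunctive normal expressions\<close>

text \<open>The families are used only at the indices \<open>1..s+t\<close> (\<open>Fk\<close>),
  \<open>1..s\<close> (\<open>G\<close>) and \<open>1..t\<close> (\<open>H\<close>).\<close>

record bdne =
  bs :: nat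
  bt :: nat
  bF :: pform
  bFk :: "nat \<Rightarrow> pform"
  bG :: "nat \<Rightarrow> pform"
  bH :: "nat \<Rightarrow> pform"
  bZ :: pform

definition is_bdne :: "bdne \<Rightarrow> bool" where
  "is_bdne S \<longleftrightarrow> bs S > 0 \<and> bt S > 0 \<and>
     bF S \<in> L0 \<union> {PEmp} \<and>
     (\<forall>k\<in>{1..bs S + bt S}. bFk S k \<in> L0 \<union> {PEmp}) \<and>
     (\<forall>i\<in>{1..bs S}. bG S i \<in> L0 \<union> {PEmp}) \<and>
     (\<forall>j\<in>{1..bt S}. bH S j \<in> L0 \<union> {PEmp}) \<and>
     bZ S \<in> L0"

primrec pform_fm :: "pform \<Rightarrow> 'p fm" where
  "pform_fm PEmp = Bot"
| "pform_fm (PVar x) = Var x"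
| "pform_fm (PNVar x) = Neg (Var x)"
| "pform_fm (PAnd a b) = And (pform_fm a) (pform_fm b)"
| "pform_fm (POr a b) = Or (pform_fm a) (pform_fm b)"

definition bdne_A :: "'p \<Rightarrow> bdne \<Rightarrow> 'p fm" where
  "bdne_A p S =
     Or (pform_fm (bF S))
       (Or (bigor Or Bot
              (map (\<lambda>i. And (pform_fm (bFk S i)) (Box (Atom p) (pform_fm (bG S i))))
                 [1..<bs S + 1]))
           (bigor Or Bot
              (map (\<lambda>j. And (pform_fm (bFk S (bs S + j))) (Dia (Atom p) (pform_fm (bH S j))))
                 [1..<bt S + 1])))"

definition bdne_fm :: "'p \<Rightarrow> bdne \<Rightarrow> 'p fm" where
  "bdne_fm p S = Or (Dia (Star (Atom p)) (bdne_A p S)) (pform_fm (bZ S))"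


section \<open>The boolean-valued function f\<close>

definition Xi :: "bdne \<Rightarrow> (nat \<Rightarrow> nat) set" where
  "Xi S = {1..bs S + bt S} \<rightarrow>\<^sub>E {1, 2}"

definition B_of :: "bdne \<Rightarrow> (nat \<Rightarrow> nat) \<Rightarrow> pform" where
  "B_of S \<xi> = POr (bF S)
     (bigor POr PEmp (map (bFk S) (filter (\<lambda>k. \<xi> k = 1) [1..<bs S + bt S + 1])))"

definition C_of :: "bdne \<Rightarrow> (nat \<Rightarrow> nat) \<Rightarrow> pform" where
  "C_of S \<xi> =
     bigor POr PEmp
       (map (\<lambda>k. bH S (k - bs S)) (filter (\<lambda>k. \<xi> k = 2) [bs S + 1..<bs S + bt S + 1]))"

definition J_of :: "bdne \<Rightarrow> (nat \<Rightarrow> nat) \<Rightarrow> nat set" where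
  "J_of S \<xi> = {k \<in> {1..bs S}. \<xi> k = 2}"

definition D_of :: "bdne \<Rightarrow> (nat \<Rightarrow> nat) \<Rightarrow> nat \<Rightarrow> pform" where
  "D_of S \<xi> j = bG S j"

primrec f_of :: "bdne \<Rightarrow> nat \<Rightarrow> pform \<Rightarrow> bool" where
  "f_of S 0 X \<longleftrightarrow>
     (\<forall>\<xi>\<in>Xi S. ptaut (POr (B_of S \<xi>) X) \<or>
        (\<exists>j\<in>J_of S \<xi>. ptaut (POr (C_of S \<xi>) (D_of S \<xi> j))))"
| "f_of S (Suc \<iota>) X \<longleftrightarrow>
     (\<forall>\<xi>\<in>Xi S. ptaut (POr (B_of S \<xi>) X) \<or>
        (\<exists>j\<in>J_of S \<xi>. f_of S \<iota> (POr (C_of S \<xi>) (D_of S \<xi> j))))"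

definition f_depth :: "bdne \<Rightarrow> nat" where
  "f_depth S = bs S * 2 ^ (bs S + bt S) + 1"


section \<open>Quantified boolean logic\<close>

datatype 'v qbf =
    QBot
  | QVar 'v
  | QNeg "'v qbf"
  | QAnd "'v qbf" "'v qbf"
  | QOr "'v qbf" "'v qbf"
  | QAll 'v "'v qbf"
  | QEx 'v "'v qbf"

abbreviation QImp :: "'v qbf \<Rightarrow> 'v qbf \<Rightarrow> 'v qbf" where
  "QImp a b \<equiv> QOr (QNeg a) b"

abbreviation QIff :: "'v qbf \<Rightarrow> 'v qbf \<Rightarrow> 'v qbf" where
  "QIff a b \<equiv> QAnd (QImp a b) (QImp b a)"

primrec qsize :: "'v qbf \<Rightarrow> nat" where
  "qsize QBot = 1"
| "qsize (QVar x) = 1"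
| "qsize (QNeg a) = qsize a + 1"
| "qsize (QAnd a b) = qsize a + qsize b + 1"
| "qsize (QOr a b) = qsize a + qsize b + 1"
| "qsize (QAll x a) = qsize a + 2"
| "qsize (QEx x a) = qsize a + 2"

primrec qfv :: "'v qbf \<Rightarrow> 'v set" where
  "qfv QBot = {}"
| "qfv (QVar x) = {x}"
| "qfv (QNeg a) = qfv a"
| "qfv (QAnd a b) = qfv a \<union> qfv b"
| "qfv (QOr a b) = qfv a \<union> qfv b"
| "qfv (QAll x a) = qfv a - {x}"
| "qfv (QEx x a) = qfv a - {x}"

text \<open>Substitution does not rename bound variables; it is only used under \<open>qfree_for\<close>.\<close>

primrec qsubst :: "'v \<Rightarrow> 'v qbf \<Rightarrow> 'v qbf \<Rightarrow> 'v qbf" where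
  "qsubst x c QBot = QBot"
| "qsubst x c (QVar y) = (if y = x then c else QVar y)"
| "qsubst x c (QNeg a) = QNeg (qsubst x c a)"
| "qsubst x c (QAnd a b) = QAnd (qsubst x c a) (qsubst x c b)"
| "qsubst x c (QOr a b) = QOr (qsubst x c a) (qsubst x c b)"
| "qsubst x c (QAll y a) = (if y = x then QAll y a else QAll y (qsubst x c a))"
| "qsubst x c (QEx y a) = (if y = x then QEx y a else QEx y (qsubst x c a))"

primrec qfree_for :: "'v \<Rightarrow> 'v qbf \<Rightarrow> 'v qbf \<Rightarrow> bool" where
  "qfree_for x c QBot = True"
| "qfree_for x c (QVar y) = True"
| "qfree_for x c (QNeg a) = qfree_for x c a"
| "qfree_for x c (QAnd a b) = (qfree_for x c a \<and> qfree_for x c b)"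
| "qfree_for x c (QOr a b) = (qfree_for x c a \<and> qfree_for x c b)"
| "qfree_for x c (QAll y a) = (x \<notin> qfv (QAll y a) \<or> y \<notin> qfv c \<and> qfree_for x c a)"
| "qfree_for x c (QEx y a) = (x \<notin> qfv (QEx y a) \<or> y \<notin> qfv c \<and> qfree_for x c a)"

fun q_beval :: "('v qbf \<Rightarrow> bool) \<Rightarrow> 'v qbf \<Rightarrow> bool" where
  "q_beval v QBot = False"
| "q_beval v (QNeg a) = (\<not> q_beval v a)"
| "q_beval v (QAnd a b) = (q_beval v a \<and> q_beval v b)"
| "q_beval v (QOr a b) = (q_beval v a \<or> q_beval v b)"
| "q_beval v a = v a"

text \<open>The usual Hilbert system: classical propositional logic plus the standard laws for
  quantifiers ranging over propositions.\<close>

inductive QBL_prov :: "'v qbf \<Rightarrow> bool" where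
  QTaut: "(\<forall>v. q_beval v a) \<Longrightarrow> QBL_prov a"
| QInst: "qfree_for x c a \<Longrightarrow> QBL_prov (QImp (QAll x a) (qsubst x c a))"
| QDist: "x \<notin> qfv a \<Longrightarrow> QBL_prov (QImp (QAll x (QImp a b)) (QImp a (QAll x b)))"
| QDual: "QBL_prov (QIff (QEx x a) (QNeg (QAll x (QNeg a))))"
| QMP: "\<lbrakk>QBL_prov (QImp a b); QBL_prov a\<rbrakk> \<Longrightarrow> QBL_prov b"
| QGen: "QBL_prov a \<Longrightarrow> QBL_prov (QAll x a)"


section \<open>The unfolding of f as a quantified boolean formula\<close>

text \<open>\<open>Prop x\<close> is the variable \<open>x\<close> of the propositional formulas. The
  quantifiers ``for every \<open>\<xi>\<close>'' and ``for some \<open>j \<in> J\<close>'' of the clause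
  for \<open>f(\<iota>, X)\<close> become boolean quantifiers over \<open>Sel \<iota> k\<close> and
  \<open>Pick \<iota> j\<close>: \<open>Sel \<iota> k\<close> is true iff \<open>\<xi>(k) = 2\<close>, and
  \<open>Pick \<iota> j\<close> is true iff \<open>j\<close> is the chosen index. Each clause thus refers
  to the next one only once; writing out a conjunction over all \<open>\<xi>\<close> and a disjunction over
  all \<open>j\<close> at every level would give a doubly exponential formula.\<close>

datatype qvar = Prop nat | Sel nat nat | Pick nat nat

abbreviation qand_list :: "'v qbf list \<Rightarrow> 'v qbf" where
  "qand_list as \<equiv> foldr QAnd as (QNeg QBot)"

primrec pform_qbf :: "pform \<Rightarrow> qvar qbf" where
  "pform_qbf PEmp = QBot"
| "pform_qbf (PVar x) = QVar (Prop x)"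
| "pform_qbf (PNVar x) = QNeg (QVar (Prop x))"
| "pform_qbf (PAnd a b) = QAnd (pform_qbf a) (pform_qbf b)"
| "pform_qbf (POr a b) = QOr (pform_qbf a) (pform_qbf b)"

definition qB :: "bdne \<Rightarrow> nat \<Rightarrow> qvar qbf" where
  "qB S \<iota> = QOr (pform_qbf (bF S))
     (bigor QOr QBot
        (map (\<lambda>k. QAnd (QNeg (QVar (Sel \<iota> k))) (pform_qbf (bFk S k)))
           [1..<bs S + bt S + 1]))"

definition qC :: "bdne \<Rightarrow> nat \<Rightarrow> qvar qbf" where
  "qC S \<iota> =
     bigor QOr QBot
       (map (\<lambda>k. QAnd (QVar (Sel \<iota> k)) (pform_qbf (bH S (k - bs S))))
          [bs S + 1..<bs S + bt S + 1])"

definition qD :: "bdne \<Rightarrow> nat \<Rightarrow> qvar qbf" where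
  "qD S \<iota> =
     bigor QOr QBot
       (map (\<lambda>j. QAnd (QVar (Pick \<iota> j)) (pform_qbf (bG S j))) [1..<bs S + 1])"

text \<open>Exactly one index is picked, and it lies in \<open>J\<close>.\<close>

definition qJ :: "bdne \<Rightarrow> nat \<Rightarrow> qvar qbf" where
  "qJ S \<iota> =
     bigor QOr QBot
       (map (\<lambda>j. QAnd (QVar (Pick \<iota> j))
                (QAnd (QVar (Sel \<iota> j))
                  (qand_list (map (\<lambda>i. QNeg (QVar (Pick \<iota> i)))
                     (filter (\<lambda>i. i \<noteq> j) [1..<bs S + 1])))))
          [1..<bs S + 1])"

text \<open>The universal closure over the propositional variables of a formula, expressing
  that it is a tautology (for given values of the \<open>Sel\<close> and \<open>Pick\<close> variables).\<close>

definition qtaut :: "qvar qbf \<Rightarrow> qvar qbf" where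
  "qtaut Y = foldr (\<lambda>x. QAll (Prop x)) (sorted_list_of_set {x. Prop x \<in> qfv Y}) Y"

definition all_sel :: "bdne \<Rightarrow> nat \<Rightarrow> qvar qbf \<Rightarrow> qvar qbf" where
  "all_sel S \<iota> = foldr (\<lambda>k. QAll (Sel \<iota> k)) [1..<bs S + bt S + 1]"

definition ex_pick :: "bdne \<Rightarrow> nat \<Rightarrow> qvar qbf \<Rightarrow> qvar qbf" where
  "ex_pick S \<iota> = foldr (\<lambda>j. QEx (Pick \<iota> j)) [1..<bs S + 1]"

primrec f_unfold :: "bdne \<Rightarrow> nat \<Rightarrow> qvar qbf \<Rightarrow> qvar qbf" where
  "f_unfold S 0 X =
     all_sel S 0
       (QOr (qtaut (QOr (qB S 0) X))
            (ex_pick S 0 (QAnd (qJ S 0) (qtaut (QOr (qC S 0) (qD S 0))))))"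
| "f_unfold S (Suc \<iota>) X =
     all_sel S (Suc \<iota>)
       (QOr (qtaut (QOr (qB S (Suc \<iota>)) X))
            (ex_pick S (Suc \<iota>)
               (QAnd (qJ S (Suc \<iota>)) (f_unfold S \<iota> (QOr (qC S (Suc \<iota>)) (qD S (Suc \<iota>)))))))"

definition bdne_hat :: "bdne \<Rightarrow> qvar qbf" where
  "bdne_hat S = f_unfold S (f_depth S) (pform_qbf (bZ S))"

end

theory Submission
  imports Defs
begin

text \<open>If \<open>f\<close> holds, PDL derives \<open>\<langle>p*\<rangle>A \<or> X\<close> by induction on the
  depth: from \<open>\<langle>p*\<rangle>A \<or> C \<or> D\<close> one gets
  \<open>\<langle>p\<rangle>\<langle>p*\<rangle>A \<or> \<langle>p\<rangle>C \<or> [p]D\<close>, and over all selections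
  \<open>\<xi>\<close> these disjunctions propositionally entail the claim. Conversely, the set of pairs
  \<open>(\<xi>, j)\<close> with \<open>f(\<iota>, C \<or> D) = 0\<close> decreases in \<open>\<iota>\<close> and
  has at most \<open>s 2^(s+t)\<close> elements, so it is stationary at the depth of the theorem, and then
  the formulas on which \<open>f\<close> fails form a Kripke countermodel. The equivalence with QBL is its
  soundness and completeness, the latter by Kalmar's method, together with an evaluation of the
  unfolding level by level.\<close>

section \<open>Finite disjunctions\<close>

lemma peval_bigor: "peval v (bigor POr PEmp as) \<longleftrightarrow> (\<exists>a\<in>set as. peval v a)"
  by (induction as rule: induct_list012) auto

lemma fm_beval_bigor: "fm_beval v (bigor Or Bot as) \<longleftrightarrow> (\<exists>a\<in>set as. fm_beval v a)"
  by (induction as rule: induct_list012) auto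

lemma pform_fm_bigor: "pform_fm (bigor POr PEmp as) = bigor Or Bot (map pform_fm as)"
  by (induction as rule: induct_list012) auto

lemma fm_beval_pform_fm: "fm_beval v (pform_fm X) \<longleftrightarrow> peval (\<lambda>x. v (Var x)) X"
  by (induction X) auto


lemma set_upt_1: "set [1..<n + 1] = {1..n}"
  by auto


section \<open>Kripke semantics and soundness of PDL\<close>

primrec prog_sem ::
    "('p \<Rightarrow> ('w \<times> 'w) set) \<Rightarrow> ('w \<Rightarrow> nat \<Rightarrow> bool) \<Rightarrow> 'p prog \<Rightarrow> ('w \<times> 'w) set"
  and fm_sem ::
    "('p \<Rightarrow> ('w \<times> 'w) set) \<Rightarrow> ('w \<Rightarrow> nat \<Rightarrow> bool) \<Rightarrow> 'p fm \<Rightarrow> 'w set" where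
  "prog_sem R V (Atom a) = R a"
| "prog_sem R V (Seq a b) = prog_sem R V a O prog_sem R V b"
| "prog_sem R V (Choice a b) = prog_sem R V a \<union> prog_sem R V b"
| "prog_sem R V (Star a) = (prog_sem R V a)\<^sup>*"
| "prog_sem R V (Test A) = Id_on (fm_sem R V A)"
| "fm_sem R V Bot = {}"
| "fm_sem R V (Var x) = {w. V w x}"
| "fm_sem R V (Neg A) = - fm_sem R V A"
| "fm_sem R V (And A B) = fm_sem R V A \<inter> fm_sem R V B"
| "fm_sem R V (Or A B) = fm_sem R V A \<union> fm_sem R V B"
| "fm_sem R V (Box a A) = {w. \<forall>u. (w, u) \<in> prog_sem R V a \<longrightarrow> u \<in> fm_sem R V A}"
| "fm_sem R V (Dia a A) = {w. \<exists>u. (w, u) \<in> prog_sem R V a \<and> u \<in> fm_sem R V A}"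

text \<open>Membership in \<open>fm_sem\<close> at a fixed world commutes with the Boolean
  connectives, so it is one of the valuations over which \<open>Taut\<close> quantifies.\<close>

lemma fm_sem_iff_fm_beval: "w \<in> fm_sem R V A \<longleftrightarrow> fm_beval (\<lambda>B. w \<in> fm_sem R V B) A"
proof -
  \<comment> \<open>The valuation becomes a variable with a defining equation because the induction
    rule of \<open>fm_beval\<close> carries it as an argument.\<close>
  have "fm_beval v A = (w \<in> fm_sem R V A)" if "v = (\<lambda>B. w \<in> fm_sem R V B)" for v
    using that by (induction v A rule: fm_beval.induct) auto
  then show ?thesis by blast
qed

text \<open>The semantic content of \<open>Ind\<close>: truth of \<open>A\<close> is carried along a
  path of \<open>a\<close>-steps, the implication being available at each world reached.\<close>

lemma fm_sem_Star_induct: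
  assumes "(w, u) \<in> (prog_sem R V a)\<^sup>*" "w \<in> fm_sem R V A"
    and "\<And>u. (w, u) \<in> (prog_sem R V a)\<^sup>* \<Longrightarrow> u \<in> fm_sem R V (Imp A (Box a A))"
  shows "u \<in> fm_sem R V A"
  using assms(1)
proof (induction rule: rtrancl_induct)
  case base
  show ?case by fact
next
  case (step y z)
  then show ?case using assms(3)[of y] by auto
qed

theorem PDL_sound: "PDL_prov A \<Longrightarrow> w \<in> fm_sem R V A"
proof (induction arbitrary: w rule: PDL_prov.induct)
  case (Taut A)
  then show ?case using fm_sem_iff_fm_beval by metis
next
  case (Mix A a)
  \<comment> \<open>A starred path is either empty or splits off its first step.\<close>
  show ?case
    by (auto intro: converse_rtrancl_into_rtrancl elim: converse_rtranclE)
next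
  case (Ind A a)
  have "w \<in> fm_sem R V (Box (Star a) A)"
    if w: "w \<in> fm_sem R V (And A (Box (Star a) (Imp A (Box a A))))"
  proof -
    have "u \<in> fm_sem R V A" if "(w, u) \<in> (prog_sem R V a)\<^sup>*" for u
      by (rule fm_sem_Star_induct[OF that]) (use w in auto)
    then show ?thesis by simp
  qed
  then show ?case unfolding fm_sem.simps(3,5) by blast
next
  case (MP A B)
  then show ?case by simp
next
  case (Nec A a)
  then show ?case by simp
qed auto

lemma fm_sem_bigor: "w \<in> fm_sem R V (bigor Or Bot as) \<longleftrightarrow> (\<exists>a\<in>set as. w \<in> fm_sem R V a)"
  by (induction as rule: induct_list012) auto

lemma fm_sem_pform_fm: "w \<in> fm_sem R V (pform_fm X) \<longleftrightarrow> peval (V w) X"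
  by (induction X) auto


section \<open>Derivations in PDL\<close>

text \<open>Premises are moved into the conclusion one at a time as antecedents. Every later
  propositional step in PDL thus reduces to listing finitely many theorems and checking Boolean
  evaluations.\<close>

lemma PDL_conseq:
  assumes "finite \<Gamma>" "\<forall>C\<in>\<Gamma>. PDL_prov C"
    and "\<forall>v. (\<forall>C\<in>\<Gamma>. fm_beval v C) \<longrightarrow> fm_beval v A"
  shows "PDL_prov A"
  using assms
proof (induction \<Gamma> arbitrary: A rule: finite_induct)
  case empty
  then show ?case by (auto intro: Taut)
next
  case (insert C \<Gamma>)
  have "PDL_prov (Imp C A)"
    by (rule insert.IH) (use insert.prems in auto)
  then show ?case using insert.prems(1) MP by blast
qed

lemma PDL_Box_mono:
  assumes "PDL_prov (Imp A B)"
  shows "PDL_prov (Imp (Box a A) (Box a B))"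
  using K MP Nec[OF assms] by blast

text \<open>Reading the premise as \<open>Neg D\<close> implies (\<open>Neg C\<close> implies
  \<open>G\<close>), necessitation and two uses of \<open>K\<close> put a box on all three, and
  duality turns the two negated boxes into diamonds. Exactly one disjunct keeps a box, which is why
  the clauses for \<open>f\<close> choose a single \<open>j\<close>.\<close>

lemma PDL_Dia_Or:
  assumes "PDL_prov (Or D (Or C G))"
  shows "PDL_prov (Or (Dia a D) (Or (Dia a C) (Box a G)))"
proof -
  have "PDL_prov (Imp (Neg D) (Imp (Neg C) G))"
    by (rule PDL_conseq[of "{Or D (Or C G)}"]) (auto simp: assms)
  from PDL_Box_mono[OF this]
  have 1: "PDL_prov (Imp (Box a (Neg D)) (Box a (Imp (Neg C) G)))" .
  show ?thesis
    by (rule PDL_conseq[of "{Imp (Box a (Neg D)) (Box a (Imp (Neg C) G)),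
          Imp (Box a (Imp (Neg C) G)) (Imp (Box a (Neg C)) (Box a G)),
          Iff (Dia a D) (Neg (Box a (Neg D))), Iff (Dia a C) (Neg (Box a (Neg C)))}"])
      (auto simp: 1 K Dual)
qed

text \<open>Dual to \<open>BoxAnd\<close>; the empty disjunction needs necessitation of the negated
  constant \<open>Bot\<close>.\<close>

lemma PDL_Dia_bigor:
  "PDL_prov (Imp (Dia a (bigor Or Bot As)) (bigor Or Bot (map (Dia a) As)))"
proof (induction As rule: induct_list012)
  case 1
  have "PDL_prov (Box a (Neg Bot))" by (rule Nec, rule Taut) simp
  then show ?case
    by (intro PDL_conseq[of "{Box a (Neg Bot), Iff (Dia a Bot) (Neg (Box a (Neg Bot)))}"])
      (auto simp: Dual)
next
  case (2 A)
  show ?case by (auto intro: Taut)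
next
  case (3 A B As)
  let ?C = "bigor Or Bot (B # As)" and ?C' = "bigor Or Bot (map (Dia a) (B # As))"
  have "PDL_prov (Imp (And (Neg A) (Neg ?C)) (Neg (Or A ?C)))" by (auto intro: Taut)
  note 1 = PDL_Box_mono[OF this, of a]
  show ?case
    by (rule PDL_conseq[of "{Imp (Box a (And (Neg A) (Neg ?C))) (Box a (Neg (Or A ?C))),
          Iff (Box a (And (Neg A) (Neg ?C))) (And (Box a (Neg A)) (Box a (Neg ?C))),
          Iff (Dia a (Or A ?C)) (Neg (Box a (Neg (Or A ?C)))),
          Iff (Dia a A) (Neg (Box a (Neg A))), Iff (Dia a ?C) (Neg (Box a (Neg ?C))),
          Imp (Dia a ?C) ?C'}"])
      (use 1 3 in \<open>auto simp: BoxAnd Dual\<close>)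
qed

lemma PDL_Dia_Star_refl: "PDL_prov (Imp A (Dia (Star a) A))"
  by (rule PDL_conseq[of "{Iff (Dia (Star a) A) (Neg (Box (Star a) (Neg A))),
        Iff (And (Neg A) (Box a (Box (Star a) (Neg A)))) (Box (Star a) (Neg A))}"])
    (auto simp: Dual Mix)

text \<open>\<open>Mix\<close> for \<open>Neg A\<close> gives that the starred box implies its own
  boxing; this is contraposed through duality, once for the star and once for
  \<open>a\<close>.\<close>

lemma PDL_Dia_Star_step: "PDL_prov (Imp (Dia a (Dia (Star a) A)) (Dia (Star a) A))"
proof -
  let ?D = "Dia (Star a) A" and ?B = "Box (Star a) (Neg A)"
  have "PDL_prov (Imp ?B (Neg ?D))"
    by (rule PDL_conseq[of "{Iff ?D (Neg ?B)}"]) (auto simp: Dual)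
  note 1 = PDL_Box_mono[OF this, of a]
  show ?thesis
    by (rule PDL_conseq[of "{Imp (Box a ?B) (Box a (Neg ?D)), Iff ?D (Neg ?B),
          Iff (Dia a ?D) (Neg (Box a (Neg ?D))), Iff (And (Neg A) (Box a ?B)) ?B}"])
      (auto simp: 1 Dual Mix)
qed

lemma ptaut_PDL: "ptaut X \<Longrightarrow> PDL_prov (pform_fm X)"
  by (auto intro: Taut simp: ptaut_def fm_beval_pform_fm)


section \<open>From f to provability in PDL\<close>

lemma finite_Xi: "finite (Xi S)"
  unfolding Xi_def by (intro finite_PiE) auto

lemma card_Xi: "card (Xi S) = 2 ^ (bs S + bt S)"
  by (simp add: Xi_def card_PiE flip: numeral_2_eq_2)

lemma Xi_range: "\<xi> \<in> Xi S \<Longrightarrow> k \<in> {1..bs S + bt S} \<Longrightarrow> \<xi> k = 1 \<or> \<xi> k = 2"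
  unfolding Xi_def by (drule (1) PiE_mem) simp

lemma peval_B_of:
  "peval v (B_of S \<xi>) \<longleftrightarrow>
     peval v (bF S) \<or> (\<exists>k\<in>{1..bs S + bt S}. \<xi> k = 1 \<and> peval v (bFk S k))"
  unfolding B_of_def peval.simps peval_bigor set_map bex_simps set_filter set_upt_1 by auto

lemma peval_C_of:
  "peval v (C_of S \<xi>) \<longleftrightarrow> (\<exists>j\<in>{1..bt S}. \<xi> (bs S + j) = 2 \<and> peval v (bH S j))"
proof -
  \<comment> \<open>The selection numbers the diamond disjuncts \<open>s+1..s+t\<close>, while the
    formulas \<open>H\<close> are numbered \<open>1..t\<close>; the image under addition of
    \<open>bs S\<close> translates.\<close>
  have "peval v (C_of S \<xi>) \<longleftrightarrow>
      (\<exists>k\<in>(+) (bs S) ` {1..bt S}. \<xi> k = 2 \<and> peval v (bH S (k - bs S)))"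
    by (force simp: C_of_def peval_bigor)
  then show ?thesis unfolding bex_simps by simp
qed

lemma fm_beval_bdne_A:
  "fm_beval v (bdne_A p S) \<longleftrightarrow> fm_beval v (pform_fm (bF S))
     \<or> (\<exists>i\<in>{1..bs S}. fm_beval v (pform_fm (bFk S i)) \<and> v (Box (Atom p) (pform_fm (bG S i))))
     \<or> (\<exists>j\<in>{1..bt S}. fm_beval v (pform_fm (bFk S (bs S + j)))
          \<and> v (Dia (Atom p) (pform_fm (bH S j))))"
  unfolding bdne_A_def fm_beval.simps fm_beval_bigor set_map bex_simps set_upt_1 ..

text \<open>Distributing disjunction over conjunction in \<open>A\<close> gives one clause per
  \<xi>: each disjunct contributes its propositional conjunct if \<xi> is 1 there and its modal
  conjunct if \<xi> is 2. Proving every clause, weakened by \<open>X\<close> and \<open>D\<close>,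
  proves \<open>A\<close> or \<open>X\<close> or \<open>D\<close>, and \<open>A\<close> implies
  \<open>D\<close>.\<close>

lemma PDL_f_step:
  fixes p :: 'p and S :: bdne
  defines "a \<equiv> Atom p"
  defines "D \<equiv> Dia (Star a) (bdne_A p S)"
  assumes f: "\<And>\<xi>. \<xi> \<in> Xi S \<Longrightarrow> ptaut (POr (B_of S \<xi>) X) \<or>
      (\<exists>j\<in>J_of S \<xi>. PDL_prov (Or D (pform_fm (POr (C_of S \<xi>) (D_of S \<xi> j)))))"
  shows "PDL_prov (Or D (pform_fm X))"
proof -
  \<comment> \<open>The weakened clause for \<xi>, evaluated with modal formulas as atoms.\<close>
  define Q where "Q = (\<lambda>v \<xi>. fm_beval v (pform_fm (POr (B_of S \<xi>) X)) \<or> fm_beval v D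
      \<or> (\<exists>i\<in>{1..bs S}. \<xi> i = 2 \<and> v (Box a (pform_fm (bG S i))))
      \<or> (\<exists>j\<in>{1..bt S}. \<xi> (bs S + j) = 2 \<and> v (Dia a (pform_fm (bH S j)))))"
  have "\<forall>\<xi>\<in>Xi S. \<exists>T. PDL_prov T \<and> (\<forall>v. fm_beval v T \<longrightarrow> Q v \<xi>)"
  proof
    fix \<xi> assume "\<xi> \<in> Xi S"
    from f[OF this] show "\<exists>T. PDL_prov T \<and> (\<forall>v. fm_beval v T \<longrightarrow> Q v \<xi>)"
    proof
      assume "ptaut (POr (B_of S \<xi>) X)"
      from ptaut_PDL[OF this] show ?thesis unfolding Q_def by blast
    next
      define ks where "ks = filter (\<lambda>k. \<xi> k = 2) [bs S + 1..<bs S + bt S + 1]"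
      define Hs :: "'p fm list" where "Hs = map (\<lambda>k. pform_fm (bH S (k - bs S))) ks"
      define C' where "C' = bigor Or Bot (map (Dia a) Hs)"
      assume "\<exists>j\<in>J_of S \<xi>. PDL_prov (Or D (pform_fm (POr (C_of S \<xi>) (D_of S \<xi> j))))"
      then obtain j where j: "j \<in> J_of S \<xi>"
        and pr: "PDL_prov (Or D (Or (bigor Or Bot Hs) (pform_fm (bG S j))))"
        by (auto simp: C_of_def D_of_def pform_fm_bigor Hs_def ks_def comp_def)
      define T where "T = Or D (Or C' (Box a (pform_fm (bG S j))))"
      \<comment> \<open>Distributing the modality over the given theorem yields
        \<open>Dia a D\<close> as one disjunct, which the star absorbs into
        \<open>D\<close>.\<close>
      have "PDL_prov T"
        by (rule PDL_conseq[of "{Or (Dia a D) (Or (Dia a (bigor Or Bot Hs)) (Box a (pform_fm (bG S j)))),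
              Imp (Dia a D) D, Imp (Dia a (bigor Or Bot Hs)) C'}"])
          (use PDL_Dia_Or[OF pr, of a] PDL_Dia_Star_step[of a] PDL_Dia_bigor[of a Hs]
            in \<open>simp_all add: T_def C'_def D_def\<close>, blast)
      moreover have "\<exists>j\<in>{1..bt S}. \<xi> (bs S + j) = 2 \<and> v (Dia a (pform_fm (bH S j)))"
        if C': "fm_beval v C'" for v
      proof -
        obtain k where "k \<in> set ks" "v (Dia a (pform_fm (bH S (k - bs S))))"
          using C' by (auto simp: C'_def Hs_def fm_beval_bigor)
        then show ?thesis by (intro bexI[of _ "k - bs S"]) (auto simp: ks_def)
      qed
      moreover have "j \<in> {1..bs S}" "\<xi> j = 2" using j by (auto simp: J_of_def)
      moreover have "fm_beval v T \<longleftrightarrow> fm_beval v D \<or> fm_beval v C' \<or> v (Box a (pform_fm (bG S j)))" for v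
        by (simp add: T_def)
      ultimately show ?thesis unfolding Q_def by blast
    qed
  qed
  then obtain T where T: "\<And>\<xi>. \<xi> \<in> Xi S \<Longrightarrow> PDL_prov (T \<xi>)"
    "\<And>\<xi> v. \<xi> \<in> Xi S \<Longrightarrow> fm_beval v (T \<xi>) \<Longrightarrow> Q v \<xi>"
    by metis
  show ?thesis
  proof (rule PDL_conseq[of "insert (Imp (bdne_A p S) D) (T ` Xi S)"])
    show "\<forall>v. (\<forall>C\<in>insert (Imp (bdne_A p S) D) (T ` Xi S). fm_beval v C) \<longrightarrow>
        fm_beval v (Or D (pform_fm X))"
    proof (intro allI impI, rule ccontr)
      fix v assume v: "\<forall>C\<in>insert (Imp (bdne_A p S) D) (T ` Xi S). fm_beval v C"
        and n: "\<not> fm_beval v (Or D (pform_fm X))"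
      then have A: "\<not> fm_beval v (bdne_A p S)" by auto
      \<comment> \<open>The selection that blames the first conjunct of each disjunct of \<open>A\<close> whenever it fails.\<close>
      define \<xi> where "\<xi> = (\<lambda>k\<in>{1..bs S + bt S}. if fm_beval v (pform_fm (bFk S k)) then 2 else 1 :: nat)"
      have \<xi>: "\<xi> \<in> Xi S" by (auto simp: Xi_def \<xi>_def)
      \<comment> \<open>Here an \<xi>-selected propositional conjunct is false by choice, and an
        \<xi>-selected modal conjunct would make its whole disjunct of \<open>A\<close> true. So the
        clause contradicts the failure of \<open>A\<close>, \<open>X\<close> and
        \<open>D\<close>.\<close>
      have "Q v \<xi>" using T(2)[OF \<xi>] v \<xi> by simp
      moreover have "\<xi> k = 2 \<longleftrightarrow> fm_beval v (pform_fm (bFk S k))"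
        "\<xi> k = 1 \<longleftrightarrow> \<not> fm_beval v (pform_fm (bFk S k))" if "k \<in> {1..bs S + bt S}" for k
        using that by (simp_all add: \<xi>_def)
      moreover have "i \<in> {1..bs S + bt S}" if "i \<in> {1..bs S}" for i using that by simp
      moreover have "bs S + j \<in> {1..bs S + bt S}" if "j \<in> {1..bt S}" for j using that by simp
      moreover have "\<not> fm_beval v D" "\<not> peval (\<lambda>x. v (Var x)) X" using n by (simp_all add: fm_beval_pform_fm)
      ultimately show False
        using A unfolding Q_def fm_beval_bdne_A fm_beval_pform_fm peval.simps peval_B_of a_def
        by metis
    qed
  qed (auto simp: D_def T(1) finite_Xi PDL_Dia_Star_refl)
qed

text \<open>At depth 0 the lower disjunction is a tautology, hence provable after weakening; at a
  successor depth it is provable by induction.\<close>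

lemma f_of_imp_PDL:
  "f_of S n X \<Longrightarrow> PDL_prov (Or (Dia (Star (Atom p)) (bdne_A p S)) (pform_fm X))"
proof (induction n arbitrary: X)
  case 0
  have "PDL_prov (Or (Dia (Star (Atom p)) (bdne_A p S)) (pform_fm Y))" if "ptaut Y" for Y
    by (rule PDL_conseq[of "{pform_fm Y}"]) (auto simp: ptaut_PDL[OF that])
  with 0 show ?case unfolding f_of.simps by (intro PDL_f_step) blast
next
  case (Suc n)
  then show ?case unfolding f_of.simps by (intro PDL_f_step) blast
qed


section \<open>From a failure of f to a countermodel\<close>

declare f_of.simps [simp del]

lemma ptaut_f_of: "ptaut X \<Longrightarrow> f_of S n X"
  by (cases n) (auto simp: ptaut_def f_of.simps)

text \<open>The only change at the bottom is that a tautology test is replaced by \<open>f\<close>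
  at depth 0, which tautologies pass.\<close>

lemma f_of_Suc: "f_of S n X \<Longrightarrow> f_of S (Suc n) X"
proof (induction n arbitrary: X)
  case 0
  then show ?case using ptaut_f_of[of _ S 0]
    unfolding f_of.simps(2) by (subst (asm) f_of.simps(1)) blast
next
  case (Suc n)
  from Suc.prems Suc.IH show ?case
    unfolding f_of.simps(2)[of S "Suc n"] by (subst (asm) f_of.simps(2)) blast
qed

text \<open>By \<open>next_eq\<close> a strict step at \<open>M\<close> forces all earlier steps to
  be strict, so the cardinality would drop \<open>M + 1\<close> times from a value of at most
  \<open>M\<close>.\<close>

lemma decreasing_chain_stable:
  assumes fin: "finite (g 0)" and card: "card (g 0) \<le> M"
    and dec: "\<And>n. g (Suc n) \<subseteq> g n"
    and next_eq: "\<And>n. g (Suc n) = g n \<Longrightarrow> g (Suc (Suc n)) = g (Suc n)"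
  shows "g (Suc M) = g M"
proof (rule ccontr)
  assume neq: "g (Suc M) \<noteq> g M"
  \<comment> \<open>Induction downwards from \<open>M\<close>.\<close>
  have "g (Suc n) \<noteq> g n" if "n \<le> M" for n
    using that by (induction n rule: inc_induct) (use neq next_eq in auto)
  moreover have "finite (g n)" for n
    by (induction n) (use fin finite_subset[OF dec] in blast)+
  ultimately have less: "card (g (Suc n)) < card (g n)" if "n \<le> M" for n
    using dec that by (intro psubset_card_mono) auto
  have "card (g n) + n \<le> card (g 0)" if "n \<le> Suc M" for n
    using that
  proof (induction n)
    case (Suc n)
    with less[of n] show ?case by simp
  qed simp
  from this[of "Suc M"] card show False by simp
qed

text \<open>The depth is one more than the number of pairs of a selection and an index, so the
  failure sets are already stationary one level below it.\<close>

lemma f_of_stable: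
  assumes "\<xi> \<in> Xi S" "j \<in> J_of S \<xi>"
    and "f_of S (f_depth S) (POr (C_of S \<xi>) (D_of S \<xi> j))"
  shows "f_of S (bs S * 2 ^ (bs S + bt S)) (POr (C_of S \<xi>) (D_of S \<xi> j))"
proof -
  define g where "g n = {(\<xi>, j) \<in> Xi S \<times> {1..bs S}. \<not> f_of S n (POr (C_of S \<xi>) (D_of S \<xi> j))}" for n
  have J: "J_of S \<xi> \<subseteq> {1..bs S}" for \<xi> by (auto simp: J_of_def)
  have mem: "f_of S n (POr (C_of S \<xi>) (D_of S \<xi> j)) \<longleftrightarrow> (\<xi>, j) \<notin> g n"
    if "\<xi> \<in> Xi S" "j \<in> J_of S \<xi>" for n \<xi> j
    using that J[of \<xi>] by (auto simp: g_def)
  have sub: "g n \<subseteq> Xi S \<times> {1..bs S}" for n by (auto simp: g_def)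
  have "g (Suc (bs S * 2 ^ (bs S + bt S))) = g (bs S * 2 ^ (bs S + bt S))"
  proof (rule decreasing_chain_stable)
    show "finite (g 0)" using sub finite_Xi by (meson finite_SigmaI finite_atLeastAtMost finite_subset)
    have "card (g 0) \<le> card (Xi S \<times> {1..bs S})"
      using sub finite_Xi by (intro card_mono) auto
    then show "card (g 0) \<le> bs S * 2 ^ (bs S + bt S)"
      by (simp add: card_Xi card_cartesian_product mult.commute)
    show "g (Suc n) \<subseteq> g n" for n using f_of_Suc unfolding g_def by blast
    fix n assume eq: "g (Suc n) = g n"
    \<comment> \<open>The clause for any \<open>X\<close> consults the level below only at these
      pairs, so agreement on them makes the next two levels equal everywhere.\<close>
    have "f_of S (Suc n) (POr (C_of S \<xi>) (D_of S \<xi> j)) \<longleftrightarrow> f_of S n (POr (C_of S \<xi>) (D_of S \<xi> j))"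
      if "\<xi> \<in> Xi S" "j \<in> J_of S \<xi>" for \<xi> j
      using eq that by (simp add: mem)
    then have "f_of S (Suc (Suc n)) X \<longleftrightarrow> f_of S (Suc n) X" for X
      by (subst (1 2) f_of.simps(2)) blast
    then show "g (Suc (Suc n)) = g (Suc n)" by (simp add: g_def)
  qed
  then show ?thesis using assms by (simp add: mem f_depth_def)
qed

lemma fm_sem_bdne_A:
  "w \<in> fm_sem R V (bdne_A p S) \<longleftrightarrow> peval (V w) (bF S)
     \<or> (\<exists>i\<in>{1..bs S}. peval (V w) (bFk S i) \<and> (\<forall>u. (w, u) \<in> R p \<longrightarrow> peval (V u) (bG S i)))
     \<or> (\<exists>j\<in>{1..bt S}. peval (V w) (bFk S (bs S + j)) \<and> (\<exists>u. (w, u) \<in> R p \<and> peval (V u) (bH S j)))"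
  unfolding bdne_A_def by (simp only: fm_sem.simps prog_sem.simps Un_iff Int_iff mem_Collect_eq
      fm_sem_bigor fm_sem_pform_fm set_map bex_simps set_upt_1)

text \<open>The worlds of the countermodel are the formulas on which \<open>f\<close> fails; each of them is
  false at itself.\<close>

lemma PDL_imp_f_of:
  fixes p :: 'p
  assumes "PDL_prov (Or (Dia (Star (Atom p)) (bdne_A p S)) (pform_fm X))"
  shows "f_of S (f_depth S) X"
proof (rule ccontr)
  assume X: "\<not> ?thesis"
  define W where "W = {Y. \<not> f_of S (f_depth S) Y}"
  have "\<exists>\<xi> v. \<xi> \<in> Xi S \<and> \<not> peval v (POr (B_of S \<xi>) Y)
      \<and> (\<forall>j\<in>J_of S \<xi>. POr (C_of S \<xi>) (D_of S \<xi> j) \<in> W)" if "Y \<in> W" for Y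
  proof -
    \<comment> \<open>Unfolding one clause yields failures one level lower;
      \<open>f_of_stable\<close> lifts them back to full depth, so the successors stay in
      \<open>W\<close>.\<close>
    have "\<not> f_of S (Suc (bs S * 2 ^ (bs S + bt S))) Y"
      using that by (simp add: W_def f_depth_def)
    then obtain \<xi> where "\<xi> \<in> Xi S" "\<not> ptaut (POr (B_of S \<xi>) Y)"
      "\<forall>j\<in>J_of S \<xi>. \<not> f_of S (bs S * 2 ^ (bs S + bt S)) (POr (C_of S \<xi>) (D_of S \<xi> j))"
      unfolding f_of.simps by blast
    then show ?thesis using f_of_stable unfolding W_def ptaut_def by blast
  qed
  then obtain \<xi> V where *: "\<And>Y. Y \<in> W \<Longrightarrow> \<xi> Y \<in> Xi S"
    "\<And>Y. Y \<in> W \<Longrightarrow> \<not> peval (V Y) (POr (B_of S (\<xi> Y)) Y)"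
    "\<And>Y j. Y \<in> W \<Longrightarrow> j \<in> J_of S (\<xi> Y) \<Longrightarrow> POr (C_of S (\<xi> Y)) (D_of S (\<xi> Y) j) \<in> W"
    by metis
  \<comment> \<open>From \<open>Y\<close> there is one edge for each index in \<open>J_of\<close> of
    the selection that witnesses the failure at \<open>Y\<close>.\<close>
  define R where "R = (\<lambda>_::'p. {(Y, POr (C_of S (\<xi> Y)) (D_of S (\<xi> Y) j)) | Y j.
      Y \<in> W \<and> j \<in> J_of S (\<xi> Y)})"
  have A: "Y \<notin> fm_sem R V (bdne_A p S)" if Y: "Y \<in> W" for Y
  proof -
    have "\<exists>u. (Y, u) \<in> R p \<and> \<not> peval (V u) (bG S i)"
      if "i \<in> {1..bs S}" "peval (V Y) (bFk S i)" for i
    proof -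
      \<comment> \<open>Value 1 would put the true formula \<open>bFk S i\<close> into
        \<open>B_of\<close>, which is false at \<open>Y\<close>.\<close>
      have "\<xi> Y i = 2" using that *(2)[OF Y] Xi_range[OF *(1)[OF Y], of i] by (auto simp: peval_B_of)
      then have i: "i \<in> J_of S (\<xi> Y)" using that by (simp add: J_of_def)
      let ?u = "POr (C_of S (\<xi> Y)) (D_of S (\<xi> Y) i)"
      have "(Y, ?u) \<in> R p" using i Y by (auto simp: R_def)
      moreover have "\<not> peval (V ?u) (bG S i)" using *(2)[OF *(3)[OF Y i]] by (auto simp: D_of_def)
      ultimately show ?thesis by blast
    qed
    moreover have "\<not> peval (V u) (bH S j)"
      if "j \<in> {1..bt S}" "peval (V Y) (bFk S (bs S + j))" "(Y, u) \<in> R p" for j u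
    proof -
      have "\<xi> Y (bs S + j) = 2"
        using that *(2)[OF Y] Xi_range[OF *(1)[OF Y], of "bs S + j"] by (auto simp: peval_B_of)
      moreover have "\<not> peval (V u) (C_of S (\<xi> Y))"
        using that(3) *(2)[OF *(3)[OF Y]] by (auto simp: R_def)
      ultimately show ?thesis using that(1) by (auto simp: peval_C_of)
    qed
    moreover have "\<not> peval (V Y) (bF S)" using *(2)[OF Y] by (auto simp: peval_B_of)
    ultimately show ?thesis unfolding fm_sem_bdne_A by blast
  qed
  have XW: "X \<in> W" using X by (simp add: W_def)
  have "Y \<in> W" if "(X, Y) \<in> (R p)\<^sup>*" for Y
    using that by (induction rule: rtrancl_induct) (use XW *(3) in \<open>auto simp: R_def\<close>)
  then have "X \<notin> fm_sem R V (Or (Dia (Star (Atom p)) (bdne_A p S)) (pform_fm X))"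
    using A *(2)[OF XW] by (auto simp: fm_sem_pform_fm)
  then show False using PDL_sound[OF assms, of X R V] by contradiction
qed


section \<open>Soundness and completeness of QBL\<close>

primrec qsat :: "('v \<Rightarrow> bool) \<Rightarrow> 'v qbf \<Rightarrow> bool" where
  "qsat v QBot \<longleftrightarrow> False"
| "qsat v (QVar x) \<longleftrightarrow> v x"
| "qsat v (QNeg a) \<longleftrightarrow> \<not> qsat v a"
| "qsat v (QAnd a b) \<longleftrightarrow> qsat v a \<and> qsat v b"
| "qsat v (QOr a b) \<longleftrightarrow> qsat v a \<or> qsat v b"
| "qsat v (QAll x a) \<longleftrightarrow> (\<forall>b. qsat (v(x := b)) a)"
| "qsat v (QEx x a) \<longleftrightarrow> (\<exists>b. qsat (v(x := b)) a)"

lemma qsat_cong: "(\<And>x. x \<in> qfv a \<Longrightarrow> v x = w x) \<Longrightarrow> qsat v a = qsat w a"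
proof (induction a arbitrary: v w)
  case (QVar x)
  then show ?case by simp
next
  case (QNeg a)
  have "qsat v a = qsat w a" by (rule QNeg.IH) (use QNeg.prems in auto)
  then show ?case by simp
next
  case (QAll y a)
  have "qsat (v(y := b)) a = qsat (w(y := b)) a" for b
    by (rule QAll.IH) (use QAll.prems in auto)
  then show ?case by simp
next
  case (QEx y a)
  have "qsat (v(y := b)) a = qsat (w(y := b)) a" for b
    by (rule QEx.IH) (use QEx.prems in auto)
  then show ?case by simp
next
  case (QAnd a b)
  have "qsat v a = qsat w a" by (rule QAnd.IH(1)) (use QAnd.prems in auto)
  moreover have "qsat v b = qsat w b" by (rule QAnd.IH(2)) (use QAnd.prems in auto)
  ultimately show ?case by simp
next
  case (QOr a b)
  have "qsat v a = qsat w a" by (rule QOr.IH(1)) (use QOr.prems in auto)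
  moreover have "qsat v b = qsat w b" by (rule QOr.IH(2)) (use QOr.prems in auto)
  ultimately show ?case by simp
qed simp

lemma qsubst_notin: "x \<notin> qfv a \<Longrightarrow> qsubst x c a = a"
  by (induction a) auto

lemma qsat_upd_notin: "x \<notin> qfv a \<Longrightarrow> qsat (v(x := b)) a = qsat v a"
  by (rule qsat_cong) auto

lemma qsat_qsubst: "qfree_for x c a \<Longrightarrow> qsat v (qsubst x c a) = qsat (v(x := qsat v c)) a"
proof (induction a arbitrary: v)
  case (QAll y a)
  show ?case
  proof (cases "x \<in> qfv (QAll y a)")
    case True
    then have "y \<noteq> x" "y \<notin> qfv c" "qfree_for x c a" using QAll.prems by auto
    \<comment> \<open>The updates can be exchanged, and updating \<open>y\<close> leaves the value
      of \<open>c\<close> unchanged because \<open>y\<close> is not free in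
      \<open>c\<close>.\<close>
    moreover have "(v(y := b))(x := d) = (v(x := d))(y := b)" for b d
      using \<open>y \<noteq> x\<close> by (rule fun_upd_twist)
    ultimately show ?thesis using QAll.IH by (simp add: qsat_upd_notin del: fun_upd_apply)
  next
    case False
    show ?thesis by (simp only: qsubst_notin[OF False] qsat_upd_notin[OF False])
  qed
next
  case (QEx y a)
  show ?case
  proof (cases "x \<in> qfv (QEx y a)")
    case True
    then have "y \<noteq> x" "y \<notin> qfv c" "qfree_for x c a" using QEx.prems by auto
    moreover have "(v(y := b))(x := d) = (v(x := d))(y := b)" for b d
      using \<open>y \<noteq> x\<close> by (rule fun_upd_twist)
    ultimately show ?thesis using QEx.IH by (simp add: qsat_upd_notin del: fun_upd_apply)
  next
    case False
    show ?thesis by (simp only: qsubst_notin[OF False] qsat_upd_notin[OF False])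
  qed
qed auto

lemma q_beval_qsat: "q_beval (qsat v) a = qsat v a"
  by (induction "qsat v" a rule: q_beval.induct) auto

theorem QBL_sound: "QBL_prov a \<Longrightarrow> qsat v a"
proof (induction arbitrary: v rule: QBL_prov.induct)
  case (QTaut a)
  then show ?case using q_beval_qsat by metis
qed (auto simp: qsat_qsubst qsat_upd_notin)

section \<open>Completeness of QBL by Kalmar's method\<close>

lemma QBL_conseq:
  assumes "finite \<Gamma>" "\<forall>c\<in>\<Gamma>. QBL_prov c"
    and "\<forall>v. (\<forall>c\<in>\<Gamma>. q_beval v c) \<longrightarrow> q_beval v a"
  shows "QBL_prov a"
  using assms
proof (induction \<Gamma> arbitrary: a rule: finite_induct)
  case empty
  then show ?case by (auto intro: QTaut)
next
  case (insert c \<Gamma>)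
  have "QBL_prov (QImp c a)"
    by (rule insert.IH) (use insert.prems in auto)
  then show ?case using insert.prems(1) QMP by blast
qed

definition literal :: "('v \<Rightarrow> bool) \<Rightarrow> 'v \<Rightarrow> 'v qbf" where
  "literal v x = (if v x then QVar x else QNeg (QVar x))"

abbreviation literals :: "('v \<Rightarrow> bool) \<Rightarrow> 'v list \<Rightarrow> 'v qbf" where
  "literals v xs \<equiv> qand_list (map (literal v) xs)"

text \<open>The signed formula of Kalmar's lemma.\<close>

definition decided :: "('v \<Rightarrow> bool) \<Rightarrow> 'v qbf \<Rightarrow> 'v qbf" where
  "decided v a = (if qsat v a then a else QNeg a)"

lemma q_beval_qand_list: "q_beval u (qand_list as) \<longleftrightarrow> (\<forall>a\<in>set as. q_beval u a)"
  by (induction as) auto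

lemma qfv_literals: "qfv (literals v xs) = set xs"
  by (induction xs) (auto simp: literal_def)

lemma literals_cong: "(\<And>x. x \<in> set xs \<Longrightarrow> v x = w x) \<Longrightarrow> literals v xs = literals w xs"
  by (induction xs) (auto simp: literal_def)

lemma QBL_All_intro:
  assumes "QBL_prov (QImp c a)" "x \<notin> qfv c"
  shows "QBL_prov (QImp c (QAll x a))"
  using QMP[OF QDist[OF assms(2)] QGen[OF assms(1)]] .

lemma QBL_All_elim: "QBL_prov (QImp (QAll x a) a)"
proof -
  have "qsubst x (QVar x) a = a" by (induction a) auto
  moreover have "qfree_for x (QVar x) a" by (induction a) auto
  ultimately show ?thesis using QInst by metis
qed

text \<open>If both values of \<open>x\<close> make \<open>a\<close> true, a case split removes the
  literal of \<open>x\<close> and generalisation applies. Otherwise some value refutes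
  \<open>a\<close>, and instantiating \<open>x\<close> by the matching constant refutes the
  quantified formula. The induction hypothesis is an explicit premise so that the existential case
  can use \<open>QNeg a\<close>.\<close>

lemma QBL_decided_QAll:
  assumes IH: "\<And>v xs. qfv a \<subseteq> set xs \<Longrightarrow> QBL_prov (QImp (literals v xs) (decided v a))"
    and xs: "qfv (QAll x a) \<subseteq> set xs"
  shows "QBL_prov (QImp (literals v xs) (decided v (QAll x a)))"
proof -
  \<comment> \<open>Without the literal of \<open>x\<close>, the context does not contain
    \<open>x\<close> free and permits generalisation.\<close>
  define G where "G = literals v (filter (\<lambda>y. y \<noteq> x) xs)"
  define l where "l b = literal (\<lambda>_. b) x" for b
  have G: "x \<notin> qfv G" by (simp add: G_def qfv_literals)
  have weak: "q_beval u (literals v xs) \<Longrightarrow> q_beval u G" for u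
    by (auto simp: G_def q_beval_qand_list)
  have step: "QBL_prov (QImp (QAnd (l b) G) (decided (v(x := b)) a))" for b
  proof -
    have "literals (v(x := b)) (x # filter (\<lambda>y. y \<noteq> x) xs) = QAnd (l b) G"
      unfolding G_def l_def by (simp add: literal_def) (rule literals_cong, simp)
    moreover have "qfv a \<subseteq> set (x # filter (\<lambda>y. y \<noteq> x) xs)" using xs by auto
    ultimately show ?thesis using IH by metis
  qed
  show ?thesis
  proof (cases "qsat v (QAll x a)")
    case True
    then have "QBL_prov (QImp (QAnd (l b) G) a)" for b
      using step[of b] by (simp add: decided_def)
    then have "QBL_prov (QImp G a)"
      by (intro QBL_conseq[of "range (\<lambda>b. QImp (QAnd (l b) G) a)"])
        (auto simp: l_def literal_def split: if_splits)
    from QBL_All_intro[OF this G] show ?thesis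
      by (intro QBL_conseq[of "{QImp G (QAll x a)}"]) (use True weak in \<open>auto simp: decided_def\<close>)
  next
    case False
    then obtain b where "\<not> qsat (v(x := b)) a" by auto
    then have 1: "QBL_prov (QImp (QAnd (l b) G) (QNeg a))"
      using step[of b] by (simp add: decided_def)
    have "QBL_prov (QImp (QAnd G (QAll x a)) (QNeg (l b)))"
      by (rule QBL_conseq[of "{QImp (QAnd (l b) G) (QNeg a), QImp (QAll x a) a}"])
        (auto simp: 1 QBL_All_elim)
    then have 2: "QBL_prov (QImp (QAnd G (QAll x a)) (QAll x (QNeg (l b))))"
      by (rule QBL_All_intro) (use G in auto)
    \<comment> \<open>Instantiating \<open>x\<close> by the constant for \<open>b\<close> refutes \<open>\<forall>x. \<not> l b\<close>.\<close>
    define c where "c = (if b then QNeg QBot else QBot :: 'a qbf)"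
    have "qfree_for x c (QNeg (l b))" by (simp add: l_def literal_def)
    note 3 = QInst[OF this]
    have "q_beval u (qsubst x c (l b))" for u by (simp add: l_def literal_def c_def)
    then show ?thesis
      by (intro QBL_conseq[of "{QImp (QAnd G (QAll x a)) (QAll x (QNeg (l b))),
            QImp (QAll x (QNeg (l b))) (qsubst x c (QNeg (l b)))}"])
        (use 2 3 False weak in \<open>auto simp: decided_def\<close>)
  qed
qed

lemma QBL_decided:
  "qfv a \<subseteq> set xs \<Longrightarrow> QBL_prov (QImp (literals v xs) (decided v a))"
proof (induction a arbitrary: v xs)
  case QBot
  show ?case by (auto intro: QTaut simp: decided_def)
next
  case (QVar x)
  have "decided v (QVar x) = literal v x" by (simp add: decided_def literal_def)
  with QVar show ?case by (intro QTaut) (auto simp: q_beval_qand_list)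
next
  case (QNeg a)
  show ?case
    by (rule QBL_conseq[of "{QImp (literals v xs) (decided v a)}"])
      (use QNeg in \<open>auto simp: decided_def split: if_splits\<close>)
next
  case (QAnd a b)
  show ?case
    by (rule QBL_conseq[of "{QImp (literals v xs) (decided v a), QImp (literals v xs) (decided v b)}"])
      (use QAnd in \<open>auto simp: decided_def split: if_splits\<close>)
next
  case (QOr a b)
  show ?case
    by (rule QBL_conseq[of "{QImp (literals v xs) (decided v a), QImp (literals v xs) (decided v b)}"])
      (use QOr in \<open>auto simp: decided_def split: if_splits\<close>)
next
  case (QAll x a)
  show ?case by (rule QBL_decided_QAll) (use QAll in auto)
next
  case (QEx x a)
  \<comment> \<open>The existential quantifier is treated through \<open>QDual\<close>, which
    requires the premise of \<open>QBL_decided_QAll\<close> for the negated body.\<close>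
  have "QBL_prov (QImp (literals v xs) (decided v (QNeg a)))" if "qfv a \<subseteq> set xs" for v xs
    by (rule QBL_conseq[of "{QImp (literals v xs) (decided v a)}"])
      (use QEx that in \<open>auto simp: decided_def split: if_splits\<close>)
  then have 1: "QBL_prov (QImp (literals v xs) (decided v (QAll x (QNeg a))))"
    by (intro QBL_decided_QAll) (use QEx in auto)
  show ?case
    by (rule QBL_conseq[of "{QImp (literals v xs) (decided v (QAll x (QNeg a))),
          QIff (QEx x a) (QNeg (QAll x (QNeg a)))}"])
      (use 1 QDual in \<open>auto simp: decided_def split: if_splits\<close>)
qed

text \<open>The head literal is eliminated by combining its two signs; distinctness ensures that
  flipping its value does not alter the remaining literals.\<close>

lemma QBL_drop_literals:
  "distinct xs \<Longrightarrow> (\<And>v. QBL_prov (QImp (literals v xs) a)) \<Longrightarrow> QBL_prov a"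
proof (induction xs)
  case Nil
  from Nil.prems(2) show ?case by (intro QBL_conseq[of "{QImp (literals (\<lambda>_. True) []) a}"]) auto
next
  case (Cons x xs)
  have "QBL_prov (QImp (literals v xs) a)" for v
  proof (rule QBL_conseq[of "range (\<lambda>b. QImp (literals (v(x := b)) (x # xs)) a)"])
    have "literals (v(x := b)) xs = literals v xs" for b
      using Cons.prems(1) by (intro literals_cong) auto
    then show "\<forall>u. (\<forall>c\<in>range (\<lambda>b. QImp (literals (v(x := b)) (x # xs)) a). q_beval u c) \<longrightarrow>
        q_beval u (QImp (literals v xs) a)"
      by (auto simp: literal_def)
  qed (use Cons.prems(2) in auto)
  then show ?case using Cons by simp
qed

lemma finite_qfv: "finite (qfv a)"
  by (induction a) auto

theorem QBL_complete:
  assumes "\<And>v. qsat v a"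
  shows "QBL_prov a"
proof -
  obtain xs where xs: "set xs = qfv a" "distinct xs"
    using finite_distinct_list[OF finite_qfv[of a]] by blast
  \<comment> \<open>A valid formula has positive sign under every valuation.\<close>
  have "decided v a = a" for v using assms by (simp add: decided_def)
  then have "QBL_prov (QImp (literals v xs) a)" for v
    using QBL_decided[of a xs v] xs(1) by simp
  then show ?thesis by (rule QBL_drop_literals[OF xs(2)])
qed


section \<open>Truth of the unfolding\<close>

text \<open>Merges one quantifier with the block after it, so that a whole prefix becomes a single
  quantifier over valuations.\<close>

lemma agree_off_insert:
  "(\<exists>b. \<forall>y. y \<notin> A \<longrightarrow> w y = (v(x := b)) y) \<longleftrightarrow> (\<forall>y. y \<notin> insert x A \<longrightarrow> w y = v y)"
    (is "?L \<longleftrightarrow> ?R")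
proof
  assume ?L
  then obtain b where "\<forall>y. y \<notin> A \<longrightarrow> w y = (v(x := b)) y" ..
  then show ?R by simp
next
  assume ?R
  then have "\<forall>y. y \<notin> A \<longrightarrow> w y = (v(x := w x)) y" by simp
  then show ?L ..
qed

lemma qsat_foldr_QAll:
  "qsat v (foldr (\<lambda>k. QAll (g k)) ks Y) \<longleftrightarrow>
     (\<forall>w. (\<forall>y. y \<notin> g ` set ks \<longrightarrow> w y = v y) \<longrightarrow> qsat w Y)"
proof (induction ks arbitrary: v)
  case Nil
  have "(\<forall>y. w y = v y) \<longleftrightarrow> w = v" for w by auto
  then show ?case by simp
next
  case (Cons k ks)
  show ?case
    unfolding foldr.simps comp_def qsat.simps Cons.IH list.set image_insert
      agree_off_insert[symmetric] by blast
qed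

lemma qsat_foldr_QEx:
  "qsat v (foldr (\<lambda>k. QEx (g k)) ks Y) \<longleftrightarrow>
     (\<exists>w. (\<forall>y. y \<notin> g ` set ks \<longrightarrow> w y = v y) \<and> qsat w Y)"
proof (induction ks arbitrary: v)
  case Nil
  have "(\<forall>y. w y = v y) \<longleftrightarrow> w = v" for w by auto
  then show ?case by simp
next
  case (Cons k ks)
  show ?case
    unfolding foldr.simps comp_def qsat.simps Cons.IH list.set image_insert
      agree_off_insert[symmetric] by blast
qed

lemma finite_Prop_qfv: "finite {x. Prop x \<in> qfv Y}"
  using finite_vimageI[OF finite_qfv[of Y], of Prop] by (simp add: vimage_def inj_def)

lemma qsat_qtaut:
  "qsat v (qtaut Y) \<longleftrightarrow> (\<forall>w. (\<forall>y. y \<notin> range Prop \<longrightarrow> w y = v y) \<longrightarrow> qsat w Y)"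
proof -
  let ?P = "Prop ` {x. Prop x \<in> qfv Y}"
  have "qsat v (qtaut Y) \<longleftrightarrow> (\<forall>w. (\<forall>y. y \<notin> ?P \<longrightarrow> w y = v y) \<longrightarrow> qsat w Y)" (is "_ \<longleftrightarrow> ?L")
    unfolding qtaut_def qsat_foldr_QAll set_sorted_list_of_set[OF finite_Prop_qfv] ..
  also have "\<dots> \<longleftrightarrow> (\<forall>w. (\<forall>y. y \<notin> range Prop \<longrightarrow> w y = v y) \<longrightarrow> qsat w Y)"
  proof (intro iffI allI impI)
    fix w assume L: ?L and w: "\<forall>y. y \<notin> range Prop \<longrightarrow> w y = v y"
    \<comment> \<open>The hybrid valuation changes only the variables actually bound by
      \<open>qtaut\<close>, yet agrees with \<open>w\<close> on all free variables of
      \<open>Y\<close>.\<close>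
    have "qsat (\<lambda>y. if y \<in> ?P then w y else v y) Y" using L by simp
    moreover have "qsat (\<lambda>y. if y \<in> ?P then w y else v y) Y = qsat w Y"
      by (rule qsat_cong) (use w in auto)
    ultimately show "qsat w Y" by simp
  next
    fix w assume L: "\<forall>w. (\<forall>y. y \<notin> range Prop \<longrightarrow> w y = v y) \<longrightarrow> qsat w Y"
      and w: "\<forall>y. y \<notin> ?P \<longrightarrow> w y = v y"
    have "w y = v y" if "y \<notin> range Prop" for y using w that by auto
    then show "qsat w Y" using L by simp
  qed
  finally show ?thesis .
qed

lemma qsat_qtaut_iff_ptaut:
  assumes "\<And>w. (\<forall>y. y \<notin> range Prop \<longrightarrow> w y = v y) \<Longrightarrow> qsat w Y = peval (\<lambda>x. w (Prop x)) Y'"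
  shows "qsat v (qtaut Y) = ptaut Y'"
proof
  assume L: "qsat v (qtaut Y)"
  have "peval z Y'" for z
  proof -
    let ?w = "\<lambda>y. case y of Prop x \<Rightarrow> z x | _ \<Rightarrow> v y"
    have w: "\<forall>y. y \<notin> range Prop \<longrightarrow> ?w y = v y" by (auto split: qvar.splits)
    show ?thesis using L[unfolded qsat_qtaut, rule_format, of ?w] w assms[OF w] by simp
  qed
  then show "ptaut Y'" by (simp add: ptaut_def)
qed (use assms in \<open>auto simp: qsat_qtaut ptaut_def\<close>)

lemma qsat_bigor: "qsat v (bigor QOr QBot as) \<longleftrightarrow> (\<exists>a\<in>set as. qsat v a)"
  by (induction as rule: induct_list012) auto

lemma qsat_qand_list: "qsat v (qand_list as) \<longleftrightarrow> (\<forall>a\<in>set as. qsat v a)"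
  by (induction as) auto

lemma qsat_pform_qbf: "qsat v (pform_qbf X) = peval (\<lambda>x. v (Prop x)) X"
  by (induction X) auto

section \<open>Coding selections and indices by valuations\<close>

definition codes_sel :: "bdne \<Rightarrow> nat \<Rightarrow> (nat \<Rightarrow> nat) \<Rightarrow> (qvar \<Rightarrow> bool) \<Rightarrow> bool" where
  "codes_sel S \<iota> \<xi> u \<longleftrightarrow> (\<forall>k\<in>{1..bs S + bt S}. u (Sel \<iota> k) \<longleftrightarrow> \<xi> k = 2)"

definition codes_pick :: "bdne \<Rightarrow> nat \<Rightarrow> nat \<Rightarrow> (qvar \<Rightarrow> bool) \<Rightarrow> bool" where
  "codes_pick S \<iota> j u \<longleftrightarrow> (\<forall>i\<in>{1..bs S}. u (Pick \<iota> i) \<longleftrightarrow> i = j)"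

text \<open>Level \<iota> of the unfolding rebinds its own variables and, inside, those of lower
  levels; what it inherits from higher levels is preserved. The \<open>Prop\<close> variables are
  unconstrained because \<open>qtaut\<close> rebinds them.\<close>

definition agree_above :: "nat \<Rightarrow> (qvar \<Rightarrow> bool) \<Rightarrow> (qvar \<Rightarrow> bool) \<Rightarrow> bool" where
  "agree_above \<iota> u v \<longleftrightarrow>
     (\<forall>\<kappa> k. \<iota> < \<kappa> \<longrightarrow> u (Sel \<kappa> k) = v (Sel \<kappa> k) \<and> u (Pick \<kappa> k) = v (Pick \<kappa> k))"

lemma qsat_qB:
  assumes "\<xi> \<in> Xi S" "codes_sel S \<iota> \<xi> u"
  shows "qsat u (qB S \<iota>) = peval (\<lambda>x. u (Prop x)) (B_of S \<xi>)"
proof -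
  have "\<not> u (Sel \<iota> k) \<longleftrightarrow> \<xi> k = 1" if "k \<in> {1..bs S + bt S}" for k
    using assms that Xi_range[OF assms(1) that] by (auto simp: codes_sel_def)
  then show ?thesis
    unfolding qB_def peval_B_of qsat.simps qsat_bigor set_map bex_simps set_upt_1 qsat_pform_qbf
    by blast
qed

lemma qsat_qC:
  assumes "codes_sel S \<iota> \<xi> u"
  shows "qsat u (qC S \<iota>) = peval (\<lambda>x. u (Prop x)) (C_of S \<xi>)"
proof -
  have "u (Sel \<iota> k) \<longleftrightarrow> \<xi> k = 2" if "k \<in> set [bs S + 1..<bs S + bt S + 1]" for k
    using assms that by (auto simp: codes_sel_def)
  then show ?thesis
    unfolding qC_def C_of_def qsat_bigor peval_bigor set_map set_filter bex_simps qsat.simps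
      qsat_pform_qbf by blast
qed

lemma qsat_qD:
  assumes "codes_pick S \<iota> j u" "j \<in> {1..bs S}"
  shows "qsat u (qD S \<iota>) = peval (\<lambda>x. u (Prop x)) (D_of S \<xi> j)"
  unfolding qD_def D_of_def qsat_bigor set_map bex_simps set_upt_1 qsat.simps qsat_pform_qbf
  using assms unfolding codes_pick_def by metis

lemma qsat_qJ:
  assumes "codes_sel S \<iota> \<xi> u"
  shows "qsat u (qJ S \<iota>) \<longleftrightarrow> (\<exists>j\<in>J_of S \<xi>. codes_pick S \<iota> j u)"
proof -
  have others: "qsat u (qand_list (map (\<lambda>i. QNeg (QVar (Pick \<iota> i)))
      (filter (\<lambda>i. i \<noteq> j) [1..<bs S + 1]))) \<longleftrightarrow> (\<forall>i\<in>{1..bs S}. i \<noteq> j \<longrightarrow> \<not> u (Pick \<iota> i))" for j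
    by (auto simp: qsat_qand_list simp del: upt_Suc)
  have "qsat u (qJ S \<iota>) \<longleftrightarrow> (\<exists>j\<in>{1..bs S}. u (Pick \<iota> j) \<and> u (Sel \<iota> j) \<and>
      (\<forall>i\<in>{1..bs S}. i \<noteq> j \<longrightarrow> \<not> u (Pick \<iota> i)))"
    unfolding qJ_def qsat_bigor set_map bex_simps qsat.simps others set_upt_1 ..
  also have "\<dots> \<longleftrightarrow> (\<exists>j\<in>{1..bs S}. \<xi> j = 2 \<and> codes_pick S \<iota> j u)"
  proof (intro bex_cong refl)
    fix j assume j: "j \<in> {1..bs S}"
    then have "u (Sel \<iota> j) \<longleftrightarrow> \<xi> j = 2" using assms by (simp add: codes_sel_def)
    then show "u (Pick \<iota> j) \<and> u (Sel \<iota> j) \<and> (\<forall>i\<in>{1..bs S}. i \<noteq> j \<longrightarrow> \<not> u (Pick \<iota> i)) \<longleftrightarrow>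
        \<xi> j = 2 \<and> codes_pick S \<iota> j u"
      using j unfolding codes_pick_def by metis
  qed
  also have "\<dots> \<longleftrightarrow> (\<exists>j\<in>J_of S \<xi>. codes_pick S \<iota> j u)"
    unfolding J_of_def by blast
  finally show ?thesis .
qed

text \<open>Handles both clauses of \<open>f\<close> at once: \<open>R\<close> is the lower part of
  the unfolding and \<open>r\<close> its intended truth value, either a tautology test or
  \<open>f\<close> at the previous depth.\<close>

lemma qsat_f_level:
  assumes X: "\<And>w. agree_above \<iota> w v \<Longrightarrow> qsat w X = peval (\<lambda>x. w (Prop x)) X'"
    and R: "\<And>u \<xi> j. \<lbrakk>agree_above \<iota> u v; \<xi> \<in> Xi S; j \<in> J_of S \<xi>; codes_sel S \<iota> \<xi> u;
      codes_pick S \<iota> j u\<rbrakk> \<Longrightarrow> qsat u R = r \<xi> j"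
  shows "qsat v (all_sel S \<iota> (QOr (qtaut (QOr (qB S \<iota>) X)) (ex_pick S \<iota> (QAnd (qJ S \<iota>) R))))
    \<longleftrightarrow> (\<forall>\<xi>\<in>Xi S. ptaut (POr (B_of S \<xi>) X') \<or> (\<exists>j\<in>J_of S \<xi>. r \<xi> j))"
proof -
  let ?body = "QOr (qtaut (QOr (qB S \<iota>) X)) (ex_pick S \<iota> (QAnd (qJ S \<iota>) R))"
  have body: "qsat u ?body \<longleftrightarrow> ptaut (POr (B_of S \<xi>) X') \<or> (\<exists>j\<in>J_of S \<xi>. r \<xi> j)"
    if u: "agree_above \<iota> u v" and \<xi>: "\<xi> \<in> Xi S" and c: "codes_sel S \<iota> \<xi> u" for u \<xi>
  proof -
    have "qsat w (QOr (qB S \<iota>) X) = peval (\<lambda>x. w (Prop x)) (POr (B_of S \<xi>) X')"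
      if "\<forall>y. y \<notin> range Prop \<longrightarrow> w y = u y" for w
    proof -
      have "w (Sel \<kappa> k) = u (Sel \<kappa> k)" "w (Pick \<kappa> k) = u (Pick \<kappa> k)" for \<kappa> k using that by auto
      then have "agree_above \<iota> w v" "codes_sel S \<iota> \<xi> w"
        using u c by (auto simp: agree_above_def codes_sel_def)
      then show ?thesis using X qsat_qB[OF \<xi>] by simp
    qed
    then have 1: "qsat u (qtaut (QOr (qB S \<iota>) X)) \<longleftrightarrow> ptaut (POr (B_of S \<xi>) X')"
      by (rule qsat_qtaut_iff_ptaut)
    have ag: "agree_above \<iota> w v" "codes_sel S \<iota> \<xi> w"
      if "\<forall>y. y \<notin> Pick \<iota> ` {1..bs S} \<longrightarrow> w y = u y" for w
    proof -
      have "w (Sel \<kappa> k) = u (Sel \<kappa> k)" "\<iota> < \<kappa> \<Longrightarrow> w (Pick \<kappa> k) = u (Pick \<kappa> k)" for \<kappa> k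
        using that by auto
      then show "agree_above \<iota> w v" "codes_sel S \<iota> \<xi> w"
        using u c by (auto simp: agree_above_def codes_sel_def)
    qed
    have "qsat u (ex_pick S \<iota> (QAnd (qJ S \<iota>) R)) \<longleftrightarrow> (\<exists>j\<in>J_of S \<xi>. r \<xi> j)"
    proof
      assume "qsat u (ex_pick S \<iota> (QAnd (qJ S \<iota>) R))"
      then obtain w where w: "\<forall>y. y \<notin> Pick \<iota> ` {1..bs S} \<longrightarrow> w y = u y" "qsat w (qJ S \<iota>)" "qsat w R"
        unfolding ex_pick_def qsat_foldr_QEx set_upt_1 qsat.simps by blast
      obtain j where j: "j \<in> J_of S \<xi>" "codes_pick S \<iota> j w"
        using w(2) qsat_qJ[OF ag(2)[OF w(1)]] by blast
      have "r \<xi> j" using R[OF ag(1)[OF w(1)] \<xi> j(1) ag(2)[OF w(1)] j(2)] w(3) by simp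
      with j(1) show "\<exists>j\<in>J_of S \<xi>. r \<xi> j" ..
    next
      assume "\<exists>j\<in>J_of S \<xi>. r \<xi> j"
      then obtain j where j: "j \<in> J_of S \<xi>" "r \<xi> j" by blast
      \<comment> \<open>Among the bound variables only the one for \<open>j\<close> is made true, so
        the uniqueness demanded by \<open>qJ\<close> holds.\<close>
      define w where "w = (\<lambda>y. if y \<in> Pick \<iota> ` {1..bs S} then y = Pick \<iota> j else u y)"
      have w: "\<forall>y. y \<notin> Pick \<iota> ` {1..bs S} \<longrightarrow> w y = u y" by (simp add: w_def)
      have "codes_pick S \<iota> j w" by (auto simp: codes_pick_def w_def)
      then have "qsat w (QAnd (qJ S \<iota>) R)"
        using R[OF ag(1)[OF w] \<xi> j(1) ag(2)[OF w]] j qsat_qJ[OF ag(2)[OF w]] by auto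
      then show "qsat u (ex_pick S \<iota> (QAnd (qJ S \<iota>) R))"
        unfolding ex_pick_def qsat_foldr_QEx set_upt_1 using w by blast
    qed
    with 1 show ?thesis by simp
  qed
  have all: "qsat v (all_sel S \<iota> ?body) \<longleftrightarrow>
      (\<forall>u. (\<forall>y. y \<notin> Sel \<iota> ` {1..bs S + bt S} \<longrightarrow> u y = v y) \<longrightarrow> qsat u ?body)"
    unfolding all_sel_def qsat_foldr_QAll set_upt_1 ..
  have ag: "agree_above \<iota> u v" if "\<forall>y. y \<notin> Sel \<iota> ` {1..bs S + bt S} \<longrightarrow> u y = v y" for u
    unfolding agree_above_def
  proof (intro allI impI conjI)
    fix \<kappa> k assume "\<iota> < \<kappa>"
    then show "u (Sel \<kappa> k) = v (Sel \<kappa> k)" "u (Pick \<kappa> k) = v (Pick \<kappa> k)"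
      using that by auto
  qed
  show ?thesis unfolding all
  proof (intro iffI ballI allI impI)
    fix \<xi> assume L: "\<forall>u. (\<forall>y. y \<notin> Sel \<iota> ` {1..bs S + bt S} \<longrightarrow> u y = v y) \<longrightarrow> qsat u ?body"
      and \<xi>: "\<xi> \<in> Xi S"
    define u where "u = (\<lambda>y. case y of
        Sel \<kappa> k \<Rightarrow> if \<kappa> = \<iota> \<and> k \<in> {1..bs S + bt S} then \<xi> k = 2 else v y | _ \<Rightarrow> v y)"
    have u: "\<forall>y. y \<notin> Sel \<iota> ` {1..bs S + bt S} \<longrightarrow> u y = v y"
      by (auto simp: u_def split: qvar.splits)
    have "codes_sel S \<iota> \<xi> u" by (auto simp: codes_sel_def u_def)
    from body[OF ag[OF u] \<xi> this] L u
    show "ptaut (POr (B_of S \<xi>) X') \<or> (\<exists>j\<in>J_of S \<xi>. r \<xi> j)" by blast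
  next
    fix u assume L: "\<forall>\<xi>\<in>Xi S. ptaut (POr (B_of S \<xi>) X') \<or> (\<exists>j\<in>J_of S \<xi>. r \<xi> j)"
      and u: "\<forall>y. y \<notin> Sel \<iota> ` {1..bs S + bt S} \<longrightarrow> u y = v y"
    \<comment> \<open>The selection is read off the valuation.\<close>
    define \<xi> where "\<xi> = (\<lambda>k\<in>{1..bs S + bt S}. if u (Sel \<iota> k) then 2 else 1 :: nat)"
    have \<xi>: "\<xi> \<in> Xi S" by (auto simp: Xi_def \<xi>_def)
    have "codes_sel S \<iota> \<xi> u" by (auto simp: codes_sel_def \<xi>_def)
    from body[OF ag[OF u] \<xi> this] L \<xi> show "qsat u ?body" by blast
  qed
qed

lemma qsat_qC_qD:
  assumes "j \<in> J_of S \<xi>" "codes_sel S \<iota> \<xi> u" "codes_pick S \<iota> j u"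
  shows "qsat u (QOr (qC S \<iota>) (qD S \<iota>)) = peval (\<lambda>x. u (Prop x)) (POr (C_of S \<xi>) (D_of S \<xi> j))"
proof -
  have "j \<in> {1..bs S}" using assms(1) by (auto simp: J_of_def)
  then show ?thesis using qsat_qC[OF assms(2)] qsat_qD[OF assms(3)] by simp
qed

lemma qsat_f_unfold:
  assumes "\<And>w. agree_above \<iota> w v \<Longrightarrow> qsat w X = peval (\<lambda>x. w (Prop x)) X'"
  shows "qsat v (f_unfold S \<iota> X) = f_of S \<iota> X'"
  using assms
proof (induction \<iota> arbitrary: v X X')
  case 0
  show ?case unfolding f_unfold.simps f_of.simps
  proof (rule qsat_f_level[OF 0])
    fix u \<xi> j
    assume j: "j \<in> J_of S \<xi>" and s: "codes_sel S 0 \<xi> u" and p: "codes_pick S 0 j u"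
    have "qsat w (QOr (qC S 0) (qD S 0)) = peval (\<lambda>x. w (Prop x)) (POr (C_of S \<xi>) (D_of S \<xi> j))"
      if "\<forall>y. y \<notin> range Prop \<longrightarrow> w y = u y" for w
    proof (rule qsat_qC_qD[OF j])
      have "w (Sel \<kappa> k) = u (Sel \<kappa> k)" "w (Pick \<kappa> k) = u (Pick \<kappa> k)" for \<kappa> k using that by auto
      then show "codes_sel S 0 \<xi> w" "codes_pick S 0 j w"
        using s p by (auto simp: codes_sel_def codes_pick_def)
    qed
    then show "qsat u (qtaut (QOr (qC S 0) (qD S 0))) = ptaut (POr (C_of S \<xi>) (D_of S \<xi> j))"
      by (rule qsat_qtaut_iff_ptaut)
  qed
next
  case (Suc \<iota>)
  show ?case unfolding f_unfold.simps f_of.simps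
  proof (rule qsat_f_level[OF Suc.prems])
    fix u \<xi> j
    assume j: "j \<in> J_of S \<xi>" and s: "codes_sel S (Suc \<iota>) \<xi> u" and p: "codes_pick S (Suc \<iota>) j u"
    \<comment> \<open>The formula passed down contains selectors of level \<open>Suc\<close>
      \<iota>, which lie above \<iota> and so keep their values in the recursive call.\<close>
    show "qsat u (f_unfold S \<iota> (QOr (qC S (Suc \<iota>)) (qD S (Suc \<iota>)))) =
        f_of S \<iota> (POr (C_of S \<xi>) (D_of S \<xi> j))"
    proof (rule Suc.IH, rule qsat_qC_qD[OF j])
      fix w assume "agree_above \<iota> w u"
      then show "codes_sel S (Suc \<iota>) \<xi> w" "codes_pick S (Suc \<iota>) j w"
        using s p by (auto simp: codes_sel_def codes_pick_def agree_above_def)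
    qed
  qed
qed

lemma qsat_bdne_hat: "qsat v (bdne_hat S) = f_of S (f_depth S) (bZ S)"
  unfolding bdne_hat_def by (rule qsat_f_unfold) (rule qsat_pform_qbf)


section \<open>Size of the unfolding\<close>

lemma fsize_pform_fm: "fsize (pform_fm X) = qsize (pform_qbf X)"
  by (induction X) auto

lemma qsize_pos: "1 \<le> qsize a"
  by (induction a) auto

lemma fsize_bigor_ge: "sum_list (map fsize as) \<le> fsize (bigor Or Bot as)"
  by (induction as rule: induct_list012) auto

text \<open>The strict inequality leaves one unit per entry to pay for the joining connective; the
  leading 1 covers the empty disjunction.\<close>

lemma qsize_bigor_map_le:
  fixes g :: "'a \<Rightarrow> 'v qbf"
  assumes "\<And>x. x \<in> set xs \<Longrightarrow> qsize (g x) < h x"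
  shows "qsize (bigor QOr QBot (map g xs)) \<le> 1 + sum_list (map h xs)"
proof -
  have "qsize (bigor QOr QBot as) \<le> 1 + (\<Sum>a\<leftarrow>as. qsize a + 1)" for as :: "'v qbf list"
    by (induction as rule: induct_list012) auto
  from this[of "map g xs"] have "qsize (bigor QOr QBot (map g xs)) \<le> 1 + (\<Sum>x\<leftarrow>xs. qsize (g x) + 1)"
    by (simp add: comp_def)
  also have "(\<Sum>x\<leftarrow>xs. qsize (g x) + 1) \<le> sum_list (map h xs)"
    by (rule sum_list_mono) (use assms in \<open>simp add: Suc_le_eq\<close>)
  finally show ?thesis by simp
qed

lemma qsize_foldr_QAll: "qsize (foldr (\<lambda>k. QAll (g k)) ks Y) = 2 * length ks + qsize Y"
  by (induction ks) auto

lemma qsize_foldr_QEx: "qsize (foldr (\<lambda>k. QEx (g k)) ks Y) = 2 * length ks + qsize Y"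
  by (induction ks) auto

lemma card_qfv_le: "card (qfv a) \<le> qsize a"
proof (induction a)
  case (QAnd a b)
  then show ?case using card_Un_le[of "qfv a" "qfv b"] by simp
next
  case (QOr a b)
  then show ?case using card_Un_le[of "qfv a" "qfv b"] by simp
next
  case (QAll x a)
  then show ?case using card_Diff1_le[of "qfv a" x] by simp
next
  case (QEx x a)
  then show ?case using card_Diff1_le[of "qfv a" x] by simp
qed auto

text \<open>Each quantifier adds 2, and there are at most as many variables as symbols.\<close>

lemma qsize_qtaut: "qsize (qtaut Y) \<le> 3 * qsize Y"
proof -
  have "card {x. Prop x \<in> qfv Y} = card (Prop ` {x. Prop x \<in> qfv Y})"
    by (rule card_image[symmetric]) (simp add: inj_on_def)
  also have "\<dots> \<le> card (qfv Y)"
    by (rule card_mono[OF finite_qfv]) auto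
  finally have "card {x. Prop x \<in> qfv Y} \<le> qsize Y" using card_qfv_le[of Y] by simp
  then show ?thesis by (simp add: qtaut_def qsize_foldr_QAll)
qed

lemma sum_list_upt_1: "(\<Sum>k\<leftarrow>[1..<n + 1]. h k) = (\<Sum>k=1..n. h k)" for h :: "nat \<Rightarrow> nat"
  unfolding interv_sum_list_conv_sum_set_nat set_upt_1 ..

lemma sum_list_upt_shift: "(\<Sum>k\<leftarrow>[m + 1..<m + n + 1]. h (k - m)) = (\<Sum>k=1..n. h k)"
  for h :: "nat \<Rightarrow> nat"
  by (induction n) auto

lemma sum_split_shift: "(\<Sum>k=1..m + n. h k) = (\<Sum>k=1..m. h k) + (\<Sum>k=1..n. h (m + k))"
  for h :: "nat \<Rightarrow> nat"
  by (induction n) auto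

lemma qsize_qand_list_le:
  "(\<And>a. a \<in> set as \<Longrightarrow> qsize a \<le> m) \<Longrightarrow> qsize (qand_list as) \<le> length as * (m + 1) + 2"
proof (induction as)
  case (Cons a as)
  have "qsize a \<le> m" using Cons.prems by simp
  moreover have "qsize (qand_list as) \<le> length as * (m + 1) + 2"
    by (rule Cons.IH) (use Cons.prems in auto)
  ultimately show ?case by simp
qed simp

lemma qsize_qJ: "qsize (qJ S \<iota>) \<le> 1 + bs S * (3 * bs S + 7)"
proof -
  let ?L = "\<lambda>j. qand_list (map (\<lambda>i. QNeg (QVar (Pick \<iota> i))) (filter (\<lambda>i. i \<noteq> j) [1..<bs S + 1]))"
  have L: "qsize (?L j) \<le> 3 * bs S + 2" for j
  proof -
    have "qsize (?L j) \<le> length (filter (\<lambda>i. i \<noteq> j) [1..<bs S + 1]) * 3 + 2"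
      by (rule order.trans[OF qsize_qand_list_le[of _ 2]]) (auto simp del: upt_Suc)
    moreover have "length (filter (\<lambda>i. i \<noteq> j) [1..<bs S + 1]) \<le> bs S"
      using length_filter_le[of "\<lambda>i. i \<noteq> j" "[1..<bs S + 1]"] by (simp del: upt_Suc)
    ultimately show ?thesis by linarith
  qed
  have "qsize (qJ S \<iota>) \<le> 1 + (\<Sum>j\<leftarrow>[1..<bs S + 1]. 3 * bs S + 7)"
    unfolding qJ_def
  proof (rule qsize_bigor_map_le)
    show "qsize (QAnd (QVar (Pick \<iota> j)) (QAnd (QVar (Sel \<iota> j)) (?L j))) < 3 * bs S + 7" for j
      unfolding qsize.simps using L[of j] by linarith
  qed
  then show ?thesis by (simp only: sum_list_triv length_upt) simp
qed

section \<open>Bounds in terms of the size of the expression\<close>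

context
  fixes p :: 'p and S :: bdne and n :: nat
  defines "n \<equiv> fsize (bdne_fm p S)"
begin

text \<open>In each modal disjunct the 3 counts the conjunction, the modality and the atomic
  program.\<close>

lemma fsize_bdne_ge:
  "qsize (pform_qbf (bF S)) + (\<Sum>i=1..bs S. qsize (pform_qbf (bFk S i)) + qsize (pform_qbf (bG S i)) + 3)
     + (\<Sum>j=1..bt S. qsize (pform_qbf (bFk S (bs S + j))) + qsize (pform_qbf (bH S j)) + 3)
     + qsize (pform_qbf (bZ S)) \<le> n"
proof -
  let ?As = "map (\<lambda>i. And (pform_fm (bFk S i)) (Box (Atom p) (pform_fm (bG S i)))) [1..<bs S + 1]"
  let ?Bs = "map (\<lambda>j. And (pform_fm (bFk S (bs S + j))) (Dia (Atom p) (pform_fm (bH S j)))) [1..<bt S + 1]"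
  have "n \<ge> qsize (pform_qbf (bF S)) + fsize (bigor Or Bot ?As) + fsize (bigor Or Bot ?Bs)
      + qsize (pform_qbf (bZ S))"
    unfolding n_def bdne_fm_def bdne_A_def fsize.simps gsize.simps fsize_pform_fm by linarith
  moreover have "(\<Sum>i=1..bs S. qsize (pform_qbf (bFk S i)) + qsize (pform_qbf (bG S i)) + 3)
      = sum_list (map fsize ?As)"
    unfolding sum_list_upt_1[symmetric] map_map comp_def
    by (intro arg_cong[of _ _ sum_list] map_cong refl) (simp add: fsize_pform_fm)
  moreover have "(\<Sum>j=1..bt S. qsize (pform_qbf (bFk S (bs S + j))) + qsize (pform_qbf (bH S j)) + 3)
      = sum_list (map fsize ?Bs)"
    unfolding sum_list_upt_1[symmetric] map_map comp_def
    by (intro arg_cong[of _ _ sum_list] map_cong refl) (simp add: fsize_pform_fm)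
  ultimately show ?thesis using fsize_bigor_ge[of ?As] fsize_bigor_ge[of ?Bs] by linarith
qed

lemma bs_bt_le: "bs S + bt S \<le> n"
proof -
  have "bs S \<le> (\<Sum>i=1..bs S. qsize (pform_qbf (bFk S i)) + qsize (pform_qbf (bG S i)) + 3)"
    using sum_mono[of "{1..bs S}" "\<lambda>_. 1 :: nat"] by simp
  moreover have
    "bt S \<le> (\<Sum>j=1..bt S. qsize (pform_qbf (bFk S (bs S + j))) + qsize (pform_qbf (bH S j)) + 3)"
    using sum_mono[of "{1..bt S}" "\<lambda>_. 1 :: nat"] by simp
  ultimately show ?thesis using fsize_bdne_ge by linarith
qed

text \<open>Guarding a formula by a negated selector costs 4 with its connective. The disjunct of
  \<open>A\<close> containing it pays 3 for its own symbols and at least 1 for the formula under the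
  modality.\<close>

lemma qsize_qB: "qsize (qB S \<iota>) \<le> n + 2"
proof -
  have "qsize (qB S \<iota>) \<le> qsize (pform_qbf (bF S)) + 2
      + (\<Sum>k\<leftarrow>[1..<bs S + bt S + 1]. qsize (pform_qbf (bFk S k)) + 4)"
    using qsize_bigor_map_le[of "[1..<bs S + bt S + 1]"
        "\<lambda>k. QAnd (QNeg (QVar (Sel \<iota> k))) (pform_qbf (bFk S k))" "\<lambda>k. qsize (pform_qbf (bFk S k)) + 4"]
    by (simp add: qB_def del: upt_Suc)
  also have "\<dots> = qsize (pform_qbf (bF S)) + 2 + ((\<Sum>i=1..bs S. qsize (pform_qbf (bFk S i)) + 4)
      + (\<Sum>j=1..bt S. qsize (pform_qbf (bFk S (bs S + j))) + 4))"
    unfolding sum_list_upt_1 sum_split_shift ..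
  also have "(\<Sum>i=1..bs S. qsize (pform_qbf (bFk S i)) + 4) \<le>
      (\<Sum>i=1..bs S. qsize (pform_qbf (bFk S i)) + qsize (pform_qbf (bG S i)) + 3)"
    by (rule sum_mono) (use qsize_pos in simp)
  also have "(\<Sum>j=1..bt S. qsize (pform_qbf (bFk S (bs S + j))) + 4) \<le>
      (\<Sum>j=1..bt S. qsize (pform_qbf (bFk S (bs S + j))) + qsize (pform_qbf (bH S j)) + 3)"
    by (rule sum_mono) (use qsize_pos in simp)
  finally show ?thesis using fsize_bdne_ge by linarith
qed

lemma qsize_qC: "qsize (qC S \<iota>) \<le> n + 1"
proof -
  have "qsize (qC S \<iota>) \<le> 1
      + (\<Sum>k\<leftarrow>[bs S + 1..<bs S + bt S + 1]. qsize (pform_qbf (bH S (k - bs S))) + 3)"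
    unfolding qC_def
    by (rule qsize_bigor_map_le) simp
  also have "\<dots> = 1 + (\<Sum>j=1..bt S. qsize (pform_qbf (bH S j)) + 3)"
    unfolding sum_list_upt_shift[where h = "\<lambda>j. qsize (pform_qbf (bH S j)) + 3"] ..
  also have "(\<Sum>j=1..bt S. qsize (pform_qbf (bH S j)) + 3) \<le>
      (\<Sum>j=1..bt S. qsize (pform_qbf (bFk S (bs S + j))) + qsize (pform_qbf (bH S j)) + 3)"
    by (rule sum_mono) simp
  finally show ?thesis using fsize_bdne_ge by linarith
qed

lemma qsize_qD: "qsize (qD S \<iota>) \<le> n + 1"
proof -
  have "qsize (qD S \<iota>) \<le> 1 + (\<Sum>j\<leftarrow>[1..<bs S + 1]. qsize (pform_qbf (bG S j)) + 3)"
    unfolding qD_def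
    by (rule qsize_bigor_map_le) simp
  also have "\<dots> = 1 + (\<Sum>j=1..bs S. qsize (pform_qbf (bG S j)) + 3)"
    unfolding sum_list_upt_1 ..
  also have "(\<Sum>j=1..bs S. qsize (pform_qbf (bG S j)) + 3) \<le>
      (\<Sum>j=1..bs S. qsize (pform_qbf (bFk S j)) + qsize (pform_qbf (bG S j)) + 3)"
    by (rule sum_mono) simp
  finally show ?thesis using fsize_bdne_ge by linarith
qed

text \<open>The lower part \<open>R\<close> enters only additively since it occurs once. The bound
  on \<open>X\<close> is that of the disjunction of \<open>qC\<close> and \<open>qD\<close>.\<close>

lemma qsize_f_level:
  assumes "qsize X \<le> 2 * n + 3"
  shows "qsize (all_sel S \<iota> (QOr (qtaut (QOr (qB S \<iota>) X)) (ex_pick S \<iota> (QAnd (qJ S \<iota>) R))))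
    \<le> 3 * n * n + 20 * n + 21 + qsize R"
proof -
  have "qsize (qJ S \<iota>) \<le> 1 + n * (3 * n + 7)"
    by (rule order.trans[OF qsize_qJ]) (use bs_bt_le in \<open>intro add_mono mult_mono, auto\<close>)
  then have "qsize (qJ S \<iota>) \<le> 1 + 3 * n * n + 7 * n" by (simp add: algebra_simps)
  moreover have "qsize (qtaut (QOr (qB S \<iota>) X)) \<le> 3 * (3 * n + 6)"
    by (rule order.trans[OF qsize_qtaut]) (use assms qsize_qB[of \<iota>] in simp)
  moreover have "bs S \<le> n" using bs_bt_le by linarith
  ultimately show ?thesis
    using bs_bt_le by (simp add: all_sel_def ex_pick_def qsize_foldr_QAll qsize_foldr_QEx del: upt_Suc)
qed

text \<open>There are \<iota> + 1 levels, and one more summand covers the tautology test at the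
  bottom.\<close>

lemma qsize_f_unfold:
  assumes "qsize X \<le> 2 * n + 3"
  shows "qsize (f_unfold S \<iota> X) \<le> (\<iota> + 2) * (3 * n * n + 20 * n + 21)"
proof -
  define k where "k = 3 * n * n + 20 * n + 21"
  have level: "qsize (all_sel S \<iota> (QOr (qtaut (QOr (qB S \<iota>) X)) (ex_pick S \<iota> (QAnd (qJ S \<iota>) R))))
      \<le> k + qsize R" if "qsize X \<le> 2 * n + 3" for \<iota> X R
    unfolding k_def by (rule qsize_f_level[OF that])
  show ?thesis
    using assms unfolding k_def[symmetric]
  proof (induction \<iota> arbitrary: X)
    case 0
    have "qsize (qtaut (QOr (qC S 0) (qD S 0))) \<le> 3 * (2 * n + 3)"
      by (rule order.trans[OF qsize_qtaut]) (use qsize_qC[of 0] qsize_qD[of 0] in simp)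
    also have "\<dots> \<le> k" unfolding k_def by simp
    finally show ?case
      using level[OF 0, of 0 "qtaut (QOr (qC S 0) (qD S 0))"] unfolding f_unfold.simps by simp
  next
    case (Suc \<iota>)
    let ?Y = "QOr (qC S (Suc \<iota>)) (qD S (Suc \<iota>))"
    have "qsize ?Y \<le> 2 * n + 3"
      using qsize_qC[of "Suc \<iota>"] qsize_qD[of "Suc \<iota>"] by simp
    from Suc.IH[OF this] level[OF Suc.prems, of "Suc \<iota>" "f_unfold S \<iota> ?Y"]
    show ?case unfolding f_unfold.simps by simp
  qed
qed

lemma qsize_bdne_hat: "qsize (bdne_hat S) \<le> 2 ^ (12 * n)"
proof -
  have n: "1 \<le> n" unfolding n_def by (simp add: bdne_fm_def)
  have exp: "n \<le> 2 ^ n" by (rule less_imp_le[OF less_exp])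
  have nn: "n \<le> n * n" "1 \<le> n * n" using n by simp_all
  \<comment> \<open>All three terms are majorised by multiples of \<open>n * n\<close>, with 3 + 20
    + 21 = 44.\<close>
  have K: "3 * n * n + 20 * n + 21 \<le> 44 * (n * n)"
    unfolding mult.assoc[of 3 n n] using nn by linarith
  have "bs S * 2 ^ (bs S + bt S) \<le> n * 2 ^ n"
    using bs_bt_le by (intro mult_mono power_increasing) auto
  moreover have "1 \<le> n * 2 ^ n" using n by simp
  ultimately have d: "f_depth S + 2 \<le> 4 * (n * 2 ^ n)" unfolding f_depth_def by linarith
  have "qsize (pform_qbf (bZ S)) \<le> 2 * n + 3" using fsize_bdne_ge by linarith
  then have "qsize (bdne_hat S) \<le> (f_depth S + 2) * (3 * n * n + 20 * n + 21)"
    unfolding bdne_hat_def by (rule qsize_f_unfold)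
  also have "\<dots> \<le> (4 * (n * 2 ^ n)) * (44 * (n * n))"
    by (rule mult_mono[OF d K]) simp_all
  also have "\<dots> = 176 * (n * n * n * 2 ^ n)" by simp
  \<comment> \<open>The constant 176 is below \<open>2 ^ 8\<close>, and each of the three factors
    \<open>n\<close> is at most \<open>2 ^ n\<close>; hence the exponent 8 + 4 = 12.\<close>
  also have "\<dots> \<le> 2 ^ (8 * n) * (2 ^ n * 2 ^ n * 2 ^ n * 2 ^ n)"
  proof (intro mult_mono exp order.refl)
    have "(2 :: nat) ^ 8 \<le> 2 ^ (8 * n)" using n by (intro power_increasing) auto
    then show "176 \<le> (2 :: nat) ^ (8 * n)" by simp
  qed simp_all
  also have "\<dots> = 2 ^ (12 * n)" by (simp flip: power_add)
  finally show ?thesis .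
qed

end

theorem mainTheorem6:
  fixes p :: 'p
  shows "\<exists>c::nat. \<forall>S. is_bdne S \<longrightarrow>
    (\<exists>Shat. Shat = bdne_hat S \<and>
       qsize Shat \<le> 2 ^ (c * fsize (bdne_fm p S)) \<and>
       (PDL_prov (bdne_fm p S) \<longleftrightarrow> f_of S (f_depth S) (bZ S)) \<and>
       (f_of S (f_depth S) (bZ S) \<longleftrightarrow> QBL_prov Shat))"
proof (intro exI[of _ 12] allI impI exI conjI)
  fix S
  show "qsize (bdne_hat S) \<le> 2 ^ (12 * fsize (bdne_fm p S))" by (rule qsize_bdne_hat)
  show "PDL_prov (bdne_fm p S) \<longleftrightarrow> f_of S (f_depth S) (bZ S)"
    unfolding bdne_fm_def by (rule iffI) (erule PDL_imp_f_of, erule f_of_imp_PDL)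
  show "f_of S (f_depth S) (bZ S) \<longleftrightarrow> QBL_prov (bdne_hat S)"
    using QBL_complete[of "bdne_hat S"] QBL_sound[of "bdne_hat S"] by (auto simp: qsat_bdne_hat)
qed (rule refl)

end
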